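(* Let $g\ge 2$ be an integer with $g\le 8$, and let $\Gamma$ be a cubic graph with $2g-2$ vertices having maximal complexity among all cubic graphs with $2g-2$ vertices. Then $\Gamma$ is $3$-connected.
   Context: A cubic graph is a finite simple graph (no loops, no multiple edges) in which every vertex has degree 3; a connected cubic graph with $b_1(\Gamma)=g$ has $2g-2$ vertices. The complexity of a graph is the number of its spanning trees. A graph $\Gamma$ is $k$-connected if for any set $S$ of $k-1$ edges of $\Gamma$, the graph $\Gamma\setminus S$ obtained by removing the edges in $S$ is still connected (so here $3$-connected refers to removing any two edges). *)

theory Defs
  imports "Graph_Theory.Digraph_Component"
begin

text \<open>
  A finite simple graph is a \<^locale>\<open>pair_graph\<close>: a finite loopfree symmetric relation, where
  the edge between u and v is represented by the two arcs (u,v) and (v,u).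
  Hence the degree of a vertex is its out-degree.
\<close>

definition cubic_graph :: "'a pair_pre_digraph \<Rightarrow> bool" where
  "cubic_graph G \<longleftrightarrow> pair_graph G \<and> (\<forall>v\<in>pverts G. out_degree G v = 3)"

definition edges :: "'a pair_pre_digraph \<Rightarrow> 'a set set" where
  "edges G = {{u, v} |u v. (u, v) \<in> parcs G}"

definition del_edges :: "'a pair_pre_digraph \<Rightarrow> 'a set set \<Rightarrow> 'a pair_pre_digraph" where
  "del_edges G S = \<lparr>pverts = pverts G, parcs = {(u, v) \<in> parcs G. {u, v} \<notin> S}\<rparr>"

text \<open>Connectivity refers to the removal of edges, not of vertices.\<close>

definition k_connected :: "nat \<Rightarrow> 'a pair_pre_digraph \<Rightarrow> bool" where
  "k_connected k G \<longleftrightarrow>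
     (\<forall>S. S \<subseteq> edges G \<and> card S = k - 1 \<longrightarrow> connected (del_edges G S))"

text \<open>
  The library's \<^const>\<open>forest\<close> and \<^const>\<open>tree\<close> are notions for digraphs: in a symmetric digraph
  every edge yields the directed cycle u, v, u of length 2. In a simple graph the undirected
  cycles are exactly the directed cycles of length at least 3.
\<close>

definition undirected_tree :: "'a pair_pre_digraph \<Rightarrow> bool" where
  "undirected_tree T \<longleftrightarrow>
     pair_graph T \<and> connected T \<and> \<not> (\<exists>p. pre_digraph.cycle T p \<and> length p \<ge> 3)"

definition complexity :: "'a pair_pre_digraph \<Rightarrow> nat" where
  "complexity G = card {T :: 'a pair_pre_digraph. undirected_tree T \<and> spanning T G}"

text \<open>
  The competing graphs have vertices in the same type as G. This is no restriction, since every
  graph with n vertices is isomorphic to one whose vertex set is that of G.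
\<close>

definition max_complexity_cubic :: "nat \<Rightarrow> 'a pair_pre_digraph \<Rightarrow> bool" where
  "max_complexity_cubic n G \<longleftrightarrow>
     cubic_graph G \<and> card (pverts G) = n \<and>
     (\<forall>H :: 'a pair_pre_digraph. cubic_graph H \<and> card (pverts H) = n \<longrightarrow>
        complexity H \<le> complexity G)"

end

theory Submission
  imports Defs "Jordan_Normal_Form.Determinant"
begin

text \<open>
  If removing two edges disconnects \<open>\<Gamma>\<close>, then \<open>\<Gamma>\<close> has a cut of at most two edges, and its spanning
  trees are counted by products of tree counts of the two sides. These are estimated by
  \<open>\<tau> \<le> C\<^sub>k L^k\<close> for every graph with \<open>L\<close> edges and first Betti number \<open>k\<close>: give the edges lengths,
  contract leaves and merge edges in series until there are at most \<open>3k - 3\<close> edges, and apply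
  \<open>k \<tau>(G) = (\<Sum>e. len e * \<tau>(G - e))\<close>, which holds since every spanning tree misses \<open>k\<close> edges. The resulting
  bounds for 8, 10, 12 and 14 vertices lie below the complexities 384, 1815, 9216 and 50421 of
  explicit cubic graphs, which are computed with the matrix-tree theorem; and a cubic graph with
  fewer vertices has no cut of at most two edges.
\<close>

section \<open>Kirchhoff polynomials of multigraphs\<close>

text \<open>The sides of a cut are no longer cubic, so the estimate may depend only on the number of
  edges and the Betti number. Lengths make an induction possible: merging two edges in series
  changes the graph but not the total length \<open>L\<close>. If every vertex meets at least 3
  edges, then \<open>3 |V| \<le> 2 |E|\<close> and \<open>|E| - |V| = k - 1\<close> give
  \<open>|E| \<le> 3 k - 3\<close>. Deleting an edge of length \<open>x\<close> leaves Betti number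
  \<open>k - 1\<close> and total length \<open>L - x\<close>, so the sum of
  \<open>x (L - x) ^ (k - 1)\<close> over the edges has to be maximised. For
  \<open>k \<ge> 2\<close> the maximum over at most \<open>3 k - 3\<close> edges is reached when
  \<open>3 k - 3\<close> edges share \<open>L\<close> equally, which is the origin of the factor in
  \<open>tree_const\<close>. If the cut has two edges, a side with \<open>2 p\<close> vertices has
  \<open>3 p - 1\<close> edges and Betti number \<open>p\<close>; identifying the feet of the cut
  edges raises the latter to \<open>p + 1\<close>. The narrowest comparison is a split into 4 and 8
  vertices, where the bound is about 85 percent of 9216.\<close>

definition multigraph :: "'v set \<Rightarrow> ('e \<Rightarrow> 'v set) \<Rightarrow> 'e set \<Rightarrow> bool" where
  "multigraph V ends E \<longleftrightarrow>
     finite V \<and> finite E \<and> (\<forall>e\<in>E. ends e \<subseteq> V \<and> ends e \<noteq> {} \<and> card (ends e) \<le> 2)"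

text \<open>Stated with cuts instead of walks, connectivity passes to contractions by taking preimages.\<close>

definition linked :: "'v set \<Rightarrow> ('e \<Rightarrow> 'v set) \<Rightarrow> 'e set \<Rightarrow> bool" where
  "linked V ends T \<longleftrightarrow>
     V \<noteq> {} \<and> (\<forall>X. X \<subseteq> V \<and> X \<noteq> {} \<and> X \<noteq> V \<longrightarrow> (\<exists>e\<in>T. ends e \<inter> X \<noteq> {} \<and> ends e - X \<noteq> {}))"

text \<open>Counting edges replaces acyclicity: no cycles have to be handled, and contracting a tree
  edge lowers both sides of the equation by one.\<close>

definition tree_set :: "'v set \<Rightarrow> ('e \<Rightarrow> 'v set) \<Rightarrow> 'e set \<Rightarrow> bool" where
  "tree_set V ends T \<longleftrightarrow> linked V ends T \<and> finite T \<and> card T + 1 = card V"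

text \<open>
  The Kirchhoff polynomial: for integer lengths, the number of spanning trees of the graph in which
  each edge \<open>e\<close> is replaced by a path of \<open>len e\<close> edges.
\<close>

definition kirch :: "'v set \<Rightarrow> ('e \<Rightarrow> 'v set) \<Rightarrow> ('e \<Rightarrow> real) \<Rightarrow> 'e set \<Rightarrow> real" where
  "kirch V ends len E = (\<Sum>T | T \<subseteq> E \<and> tree_set V ends T. \<Prod>e\<in>E - T. len e)"

definition merge :: "'v \<Rightarrow> 'v \<Rightarrow> 'v \<Rightarrow> 'v" where
  "merge u v x = (if x = v then u else x)"

text \<open>Edges keep their names under contraction, so parallel edges stay distinct, and an edge
  parallel to the contracted one becomes a loop, that is, an edge with a singleton set of
  ends.\<close>

abbreviation contract :: "'v \<Rightarrow> 'v \<Rightarrow> ('e \<Rightarrow> 'v set) \<Rightarrow> 'e \<Rightarrow> 'v set" where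
  "contract u v ends \<equiv> \<lambda>e. merge u v ` ends e"

section \<open>Contraction, connectivity and spanning trees\<close>

lemma multigraph_subset: "multigraph V ends E \<Longrightarrow> F \<subseteq> E \<Longrightarrow> multigraph V ends F"
  unfolding multigraph_def by (auto intro: finite_subset)

lemma multigraph_contract:
  assumes "multigraph V ends E" "u \<in> V" "u \<noteq> v"
  shows "multigraph (V - {v}) (contract u v ends) E"
  unfolding multigraph_def
proof (intro conjI ballI)
  fix e assume "e \<in> E"
  hence e: "ends e \<subseteq> V" "ends e \<noteq> {}" "card (ends e) \<le> 2"
    using assms by (auto simp: multigraph_def)
  show "merge u v ` ends e \<subseteq> V - {v}" "merge u v ` ends e \<noteq> {}"
    using e assms by (auto simp: merge_def)
  have "finite (ends e)" using e(1) assms(1) by (auto simp: multigraph_def intro: finite_subset)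
  thus "card (merge u v ` ends e) \<le> 2" using card_image_le[of "ends e" "merge u v"] e(3) by linarith
qed (use assms in \<open>auto simp: multigraph_def\<close>)

lemma nonloop_ends:
  assumes "multigraph V ends E" "e \<in> E" "v \<in> ends e" "ends e \<noteq> {v}"
  obtains u where "u \<in> V" "u \<noteq> v" "ends e = {u, v}"
proof -
  have e: "ends e \<subseteq> V" "card (ends e) \<le> 2" "finite (ends e)"
    using assms(1,2) by (auto simp: multigraph_def intro: finite_subset)
  obtain u where u: "u \<in> ends e" "u \<noteq> v" using assms(3,4) by blast
  have "card {u, v} = 2" using u by simp
  hence "ends e = {u, v}" using card_seteq[OF e(3), of "{u, v}"] u assms(3) e(2) by auto
  thus thesis using that u e(1) by blast
qed

lemma linked_mono: "linked V ends T \<Longrightarrow> T \<subseteq> T' \<Longrightarrow> linked V ends T'"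
  unfolding linked_def by blast

text \<open>Vertex sets of the contraction correspond to the vertex sets that do not separate
  \<open>u\<close> from \<open>v\<close>. The sets that do separate them are crossed by
  \<open>e\<close> itself.\<close>

lemma linked_contract:
  assumes "ends e = {u, v}" "u \<noteq> v" "u \<in> V" "v \<in> V"
  shows "linked V ends (insert e T) \<longleftrightarrow> linked (V - {v}) (contract u v ends) T"
proof
  assume L: "linked V ends (insert e T)"
  show "linked (V - {v}) (contract u v ends) T"
    unfolding linked_def
  proof (intro conjI allI impI)
    show "V - {v} \<noteq> {}" using assms by auto
    fix X assume X: "X \<subseteq> V - {v} \<and> X \<noteq> {} \<and> X \<noteq> V - {v}"
    define Y where "Y = (if u \<in> X then insert v X else X)"
    have Y: "Y \<subseteq> V" "Y \<noteq> {}" "Y \<noteq> V" using X assms by (auto simp: Y_def split: if_splits)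
    have mY: "merge u v y \<in> X \<longleftrightarrow> y \<in> Y" for y
      using X assms(2) by (auto simp: merge_def Y_def)
    obtain f where f: "f \<in> insert e T" "ends f \<inter> Y \<noteq> {}" "ends f - Y \<noteq> {}"
      using L Y unfolding linked_def by blast
    have "f \<noteq> e" using f assms X by (auto simp: Y_def split: if_splits)
    hence "f \<in> T" using f by blast
    moreover have "merge u v ` ends f \<inter> X \<noteq> {}" "merge u v ` ends f - X \<noteq> {}"
      using f(2,3) mY by blast+
    ultimately show "\<exists>e\<in>T. merge u v ` ends e \<inter> X \<noteq> {} \<and> merge u v ` ends e - X \<noteq> {}" by blast
  qed
next
  assume L: "linked (V - {v}) (contract u v ends) T"
  show "linked V ends (insert e T)"
    unfolding linked_def
  proof (intro conjI allI impI)
    show "V \<noteq> {}" using assms by auto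
    fix X assume X: "X \<subseteq> V \<and> X \<noteq> {} \<and> X \<noteq> V"
    show "\<exists>e\<in>insert e T. ends e \<inter> X \<noteq> {} \<and> ends e - X \<noteq> {}"
    proof (cases "u \<in> X \<longleftrightarrow> v \<in> X")
      case False
      thus ?thesis using assms(1) by auto
    next
      case True
      have "X - {v} \<subseteq> V - {v}" "X - {v} \<noteq> {}" "X - {v} \<noteq> V - {v}"
        using True X assms by auto
      then obtain f where f: "f \<in> T" "merge u v ` ends f \<inter> (X - {v}) \<noteq> {}"
          "merge u v ` ends f - (X - {v}) \<noteq> {}"
        using L unfolding linked_def by blast
      have "merge u v y \<in> X - {v} \<longleftrightarrow> y \<in> X" for y
        using True assms(2) by (auto simp: merge_def)
      hence "ends f \<inter> X \<noteq> {}" "ends f - X \<noteq> {}" using f(2,3) by blast+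
      thus ?thesis using f(1) by blast
    qed
  qed
qed

lemma tree_set_contract:
  assumes "ends e = {u, v}" "u \<noteq> v" "u \<in> V" "v \<in> V" "finite V" "e \<notin> T"
  shows "tree_set V ends (insert e T) \<longleftrightarrow> tree_set (V - {v}) (contract u v ends) T"
proof -
  have "card V = Suc (card (V - {v}))" using assms(4,5) by (metis card_Suc_Diff1)
  thus ?thesis using linked_contract[where ?ends = ends, OF assms(1-4)] assms(6) by (auto simp: tree_set_def)
qed

lemma isolated_not_linked:
  assumes "v \<in> V" "V \<noteq> {v}" "\<And>e. e \<in> E \<Longrightarrow> v \<in> ends e \<Longrightarrow> ends e = {v}"
  shows "\<not> linked V ends E"
proof
  assume "linked V ends E"
  moreover have "{v} \<subseteq> V" "{v} \<noteq> {}" "{v} \<noteq> V" using assms by auto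
  ultimately obtain e where "e \<in> E" "ends e \<inter> {v} \<noteq> {}" "ends e - {v} \<noteq> {}"
    unfolding linked_def by blast
  thus False using assms(3)[of e] by auto
qed

text \<open>Contract an edge that leaves some vertex \<open>v\<close>; a tree of the contraction
  together with that edge is a tree of the graph.\<close>

lemma tree_set_exists:
  assumes "multigraph V ends T" "linked V ends T"
  shows "\<exists>T'\<subseteq>T. tree_set V ends T'"
  using assms
proof (induction "card V" arbitrary: V ends T rule: less_induct)
  case less
  have fV: "finite V" using less.prems by (simp add: multigraph_def)
  obtain v where v: "v \<in> V" using less.prems(2) by (auto simp: linked_def)
  show ?case
  proof (cases "V = {v}")
    case True
    have "linked V ends {}" unfolding linked_def using True by auto
    hence "tree_set V ends {}" using True by (simp add: tree_set_def)
    thus ?thesis by blast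
  next
    case False
    then obtain e where e: "e \<in> T" "ends e \<inter> {v} \<noteq> {}" "ends e - {v} \<noteq> {}"
      using isolated_not_linked[of v V T ends] less.prems(2) v by blast
    then obtain u where u: "u \<in> V" "u \<noteq> v" "ends e = {u, v}"
      using nonloop_ends[OF less.prems(1) e(1), of v] by blast
    have "insert e (T - {e}) = T" using e(1) by blast
    hence "linked (V - {v}) (contract u v ends) (T - {e})"
      using linked_contract[where ?ends = ends, OF u(3,2,1) v, of "T - {e}"] less.prems(2) by simp
    moreover have "multigraph (V - {v}) (contract u v ends) (T - {e})"
      using multigraph_contract[OF multigraph_subset[OF less.prems(1)] u(1,2)] by blast
    moreover have "card (V - {v}) < card V" using v fV by (metis card_Diff1_less)
    ultimately obtain T' where T': "T' \<subseteq> T - {e}" "tree_set (V - {v}) (contract u v ends) T'"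
      using less.hyps by blast
    hence "tree_set V ends (insert e T')"
      using tree_set_contract[where ?ends = ends, OF u(3,2,1) v fV] by blast
    thus ?thesis using T'(1) e(1) by blast
  qed
qed

lemma linked_card:
  assumes "multigraph V ends T" "linked V ends T"
  shows "card V \<le> card T + 1"
proof -
  obtain T' where "T' \<subseteq> T" "tree_set V ends T'" using tree_set_exists[OF assms] by blast
  thus ?thesis using assms(1) card_mono[of T T'] by (auto simp: tree_set_def multigraph_def)
qed

lemma tree_set_minimal:
  assumes "multigraph V ends T" "tree_set V ends T" "e \<in> T"
  shows "\<not> linked V ends (T - {e})"
proof
  assume "linked V ends (T - {e})"
  hence "card V \<le> card (T - {e}) + 1"
    using linked_card[OF multigraph_subset[OF assms(1)]] by blast
  moreover have "card (T - {e}) < card T" using assms(2,3) by (metis card_Diff1_less tree_set_def)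
  ultimately show False using assms(2) by (simp add: tree_set_def)
qed

section \<open>Deletion-contraction and Euler's identity for the Kirchhoff polynomial\<close>

lemma kirch_insert:
  assumes "finite E" "e \<notin> E"
  shows "kirch V ends len (insert e E) = len e * kirch V ends len E
     + (\<Sum>T | T \<subseteq> E \<and> tree_set V ends (insert e T). \<Prod>f\<in>E - T. len f)"
proof -
  let ?A = "{T. T \<subseteq> E \<and> tree_set V ends T}" and ?B = "{T. T \<subseteq> E \<and> tree_set V ends (insert e T)}"
  have "{T. T \<subseteq> insert e E \<and> tree_set V ends T} = ?A \<union> insert e ` ?B"
  proof (intro equalityI subsetI)
    fix T assume T: "T \<in> {T. T \<subseteq> insert e E \<and> tree_set V ends T}"
    show "T \<in> ?A \<union> insert e ` ?B"
    proof (cases "e \<in> T")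
      case True
      hence "T = insert e (T - {e})" "T - {e} \<in> ?B" using T by (auto simp: insert_absorb)
      thus ?thesis by blast
    qed (use T in auto)
  qed auto
  moreover have "?A \<inter> insert e ` ?B = {}" using assms by auto
  moreover have "finite ?A" "finite ?B" using assms by auto
  moreover have "inj_on (insert e) ?B"
    using assms(2) by (intro inj_onI) (metis (no_types, lifting) mem_Collect_eq insert_ident subsetD)
  ultimately have "kirch V ends len (insert e E) = (\<Sum>T\<in>?A. \<Prod>f\<in>insert e E - T. len f)
      + (\<Sum>T\<in>?B. \<Prod>f\<in>insert e E - insert e T. len f)"
    unfolding kirch_def by (simp add: sum.union_disjoint sum.reindex)
  also have "(\<Sum>T\<in>?A. \<Prod>f\<in>insert e E - T. len f) = (\<Sum>T\<in>?A. len e * (\<Prod>f\<in>E - T. len f))"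
  proof (rule sum.cong)
    fix T assume "T \<in> ?A"
    hence "insert e E - T = insert e (E - T)" using assms by auto
    thus "(\<Prod>f\<in>insert e E - T. len f) = len e * (\<Prod>f\<in>E - T. len f)" using assms by simp
  qed simp
  also have "(\<Sum>T\<in>?B. \<Prod>f\<in>insert e E - insert e T. len f) = (\<Sum>T\<in>?B. \<Prod>f\<in>E - T. len f)"
    using assms by (intro sum.cong refl arg_cong[where f = "prod len"]) auto
  finally show ?thesis by (simp add: kirch_def sum_distrib_left)
qed

lemma kirch_insert_nonloop:
  assumes "finite E" "e \<notin> E" "finite V" "ends e = {u, v}" "u \<noteq> v" "u \<in> V" "v \<in> V"
  shows "kirch V ends len (insert e E) =
    len e * kirch V ends len E + kirch (V - {v}) (contract u v ends) len E"
proof -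
  have "{T. T \<subseteq> E \<and> tree_set V ends (insert e T)} =
      {T. T \<subseteq> E \<and> tree_set (V - {v}) (contract u v ends) T}"
    using tree_set_contract[where ?ends = ends, OF assms(4-7,3)] assms(2) by blast
  thus ?thesis unfolding kirch_insert[OF assms(1,2)] by (simp add: kirch_def)
qed

lemma kirch_unlinked: "\<not> linked V ends E \<Longrightarrow> kirch V ends len E = 0"
  unfolding kirch_def using linked_mono by (intro sum.neutral) (auto simp: tree_set_def)

lemma kirch_cong:
  assumes "\<And>e. e \<in> E \<Longrightarrow> ends e = ends' e" "\<And>e. e \<in> E \<Longrightarrow> len e = len' e"
  shows "kirch V ends len E = kirch V ends' len' E"
proof -
  have "tree_set V ends T = tree_set V ends' T" if "T \<subseteq> E" for T
    using that assms(1) unfolding tree_set_def linked_def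
    by (metis (no_types, lifting) subsetD)
  thus ?thesis unfolding kirch_def using assms(2) by (intro sum.cong prod.cong) auto
qed

text \<open>Euler's identity for a homogeneous polynomial of degree \<open>k\<close>: each length
  occurs at most linearly, so the partial derivative in \<open>len e\<close> is the polynomial of
  \<open>E - {e}\<close>.\<close>

lemma kirch_euler:
  assumes "finite E" "card E + 1 = card V + k"
  shows "real k * kirch V ends len E = (\<Sum>e\<in>E. len e * kirch V ends len (E - {e}))"
proof -
  let ?A = "{T. T \<subseteq> E \<and> tree_set V ends T}"
  have fA: "finite ?A" using assms(1) by auto
  have "(\<Sum>e\<in>E. len e * kirch V ends len (E - {e})) =
      (\<Sum>e\<in>E. \<Sum>T | T \<in> ?A \<and> e \<notin> T. \<Prod>f\<in>E - T. len f)"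
  proof (rule sum.cong[OF refl])
    fix e assume e: "e \<in> E"
    have "{T. T \<subseteq> E - {e} \<and> tree_set V ends T} = {T. T \<in> ?A \<and> e \<notin> T}" by auto
    hence "len e * kirch V ends len (E - {e}) =
        (\<Sum>T | T \<in> ?A \<and> e \<notin> T. len e * (\<Prod>f\<in>E - {e} - T. len f))"
      unfolding kirch_def sum_distrib_left by simp
    also have "\<dots> = (\<Sum>T | T \<in> ?A \<and> e \<notin> T. \<Prod>f\<in>E - T. len f)"
    proof (rule sum.cong[OF refl])
      fix T assume "T \<in> {T. T \<in> ?A \<and> e \<notin> T}"
      hence "E - T = insert e (E - {e} - T)" using e by auto
      thus "len e * (\<Prod>f\<in>E - {e} - T. len f) = (\<Prod>f\<in>E - T. len f)"
        using assms(1) by simp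
    qed
    finally show "len e * kirch V ends len (E - {e}) = (\<Sum>T | T \<in> ?A \<and> e \<notin> T. \<Prod>f\<in>E - T. len f)" .
  qed
  also have "\<dots> = (\<Sum>T\<in>?A. \<Sum>e | e \<in> E \<and> e \<notin> T. \<Prod>f\<in>E - T. len f)"
    by (rule sum.swap_restrict[OF assms(1) fA])
  also have "\<dots> = (\<Sum>T\<in>?A. real k * (\<Prod>f\<in>E - T. len f))"
  proof (rule sum.cong[OF refl])
    fix T assume T: "T \<in> ?A"
    hence "card (E - T) = k"
      using assms card_Diff_subset[of T E] by (auto simp: tree_set_def)
    moreover have "{e. e \<in> E \<and> e \<notin> T} = E - T" by auto
    ultimately show "(\<Sum>e | e \<in> E \<and> e \<notin> T. \<Prod>f\<in>E - T. len f) = real k * (\<Prod>f\<in>E - T. len f)" by simp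
  qed
  finally show ?thesis by (simp add: kirch_def sum_distrib_left)
qed

section \<open>An upper bound for the number of spanning trees\<close>

lemma tangent_power_bound:
  fixes x a L :: real
  assumes "0 \<le> a" "x \<le> L" "(real k + 2) * a \<le> L"
  shows "x * (L - x) ^ Suc k \<le> (L - a) ^ k * (x * (L - (real k + 2) * a) + (real k + 1) * a\<^sup>2)"
  using assms
proof (induction k)
  case 0
  have "0 \<le> (x - a)\<^sup>2" by simp
  thus ?case by (simp add: power2_eq_square algebra_simps)
next
  case (Suc k)
  have le: "(real k + 2) * a \<le> L"
    using Suc.prems by (simp add: algebra_simps)
  have La: "0 \<le> L - a"
  proof -
    have "0 \<le> (real k + 1) * a" using Suc.prems by simp
    thus ?thesis using le by (simp add: algebra_simps)
  qed
  define B where "B = x * (L - (real k + 2) * a) + (real k + 1) * a\<^sup>2"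
  define B' where "B' = x * (L - (real (Suc k) + 2) * a) + (real (Suc k) + 1) * a\<^sup>2"
  \<comment> \<open>Passing to the next degree loses a nonnegative multiple of
    \<open>(x - a)\<^sup>2\<close>, so the two sides still touch at \<open>a\<close>.\<close>
  have "(L - a) * B' - (L - x) * B = (L - (real k + 2) * a) * (x - a)\<^sup>2"
    unfolding B_def B'_def by (simp add: power2_eq_square algebra_simps)
  moreover have "0 \<le> (L - (real k + 2) * a) * (x - a)\<^sup>2" using le by simp
  ultimately have BB: "(L - x) * B \<le> (L - a) * B'" by linarith
  have "x * (L - x) ^ Suc (Suc k) = (L - x) * (x * (L - x) ^ Suc k)" by simp
  also have "\<dots> \<le> (L - x) * ((L - a) ^ k * B)"
    using Suc.IH[OF Suc.prems(1,2) le] Suc.prems(2) unfolding B_def by (intro mult_left_mono) auto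
  also have "\<dots> = (L - a) ^ k * ((L - x) * B)" by simp
  also have "\<dots> \<le> (L - a) ^ k * ((L - a) * B')"
    using BB La by (intro mult_left_mono) auto
  finally show ?case by (simp add: B'_def algebra_simps)
qed

text \<open>For \<open>k = 0\<close> the factor is \<open>(1 - 1 / 0) ^ 0 = 1\<close>.\<close>

primrec tree_const :: "nat \<Rightarrow> real" where
  "tree_const 0 = 1"
| "tree_const (Suc k) = tree_const k / (real k + 1) * (1 - 1 / (3 * real k)) ^ k"

lemma tree_const_nonneg: "0 \<le> tree_const k"
proof (induction k)
  case (Suc k)
  have "0 \<le> 1 - 1 / (3 * real k)" by (cases k) (auto simp: field_simps)
  thus ?case using Suc by simp
qed simp

text \<open>The tangents are taken at the equal share \<open>a\<close> of the total length among
  \<open>3 * Suc k\<close> edges. Their linear parts add up to a multiple of the total length, and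
  their constant parts are nonnegative, so having fewer edges can only help.\<close>

lemma sum_tangent_bound:
  fixes len :: "'e \<Rightarrow> real"
  assumes "finite E" "card E \<le> 3 * Suc k" "\<And>e. e \<in> E \<Longrightarrow> 0 \<le> len e"
  shows "(\<Sum>e\<in>E. len e * (sum len E - len e) ^ Suc k) \<le>
    (1 - 1 / (3 * real (Suc k))) ^ Suc k * sum len E ^ Suc (Suc k)"
proof -
  define L where "L = sum len E"
  define a where "a = L / (3 * real (Suc k))"
  have L0: "0 \<le> L" unfolding L_def using assms(3) by (rule sum_nonneg)
  hence a0: "0 \<le> a" by (simp add: a_def)
  have aL: "3 * real (Suc k) * a = L" by (simp add: a_def field_simps)
  have ka: "(real k + 2) * a \<le> L"
  proof -
    have "(real k + 2) * a \<le> 3 * real (Suc k) * a" using a0 by (intro mult_right_mono) auto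
    thus ?thesis using aL by simp
  qed
  have La: "0 \<le> L - a"
  proof -
    have "1 * a \<le> 3 * real (Suc k) * a" using a0 by (intro mult_right_mono) auto
    thus ?thesis using aL by simp
  qed
  have Ea: "real (card E) * a \<le> L"
  proof -
    have "real (card E) \<le> 3 * real (Suc k)" using assms(2) by linarith
    hence "real (card E) * a \<le> 3 * real (Suc k) * a" using a0 by (intro mult_right_mono)
    thus ?thesis using aL by simp
  qed
  have "(\<Sum>e\<in>E. len e * (L - len e) ^ Suc k) \<le>
      (\<Sum>e\<in>E. (L - a) ^ k * (len e * (L - (real k + 2) * a) + (real k + 1) * a\<^sup>2))"
  proof (rule sum_mono)
    fix e assume e: "e \<in> E"
    have "len e \<le> L" unfolding L_def using e assms(1,3) by (intro member_le_sum) auto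
    thus "len e * (L - len e) ^ Suc k \<le> (L - a) ^ k * (len e * (L - (real k + 2) * a) + (real k + 1) * a\<^sup>2)"
      using tangent_power_bound[OF a0 _ ka] by blast
  qed
  also have "\<dots> = (L - a) ^ k * (L * (L - (real k + 2) * a) + (real k + 1) * a * (real (card E) * a))"
    unfolding sum_distrib_left[symmetric] sum.distrib sum_distrib_right[symmetric]
    by (simp add: L_def power2_eq_square algebra_simps)
  also have "\<dots> \<le> (L - a) ^ k * (L * (L - (real k + 2) * a) + (real k + 1) * a * L)"
    using La a0 Ea by (intro mult_left_mono add_left_mono) auto
  also have "\<dots> = (L - a) ^ Suc k * L" by (simp add: algebra_simps)
  also have "L - a = (1 - 1 / (3 * real (Suc k))) * L" by (simp add: a_def algebra_simps)
  also have "((1 - 1 / (3 * real (Suc k))) * L) ^ Suc k * L =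
      (1 - 1 / (3 * real (Suc k))) ^ Suc k * L ^ Suc (Suc k)"
    by (simp only: power_mult_distrib power_Suc2[of L "Suc k"] mult.assoc)
  finally show ?thesis by (simp only: L_def)
qed

text \<open>The polynomial is affine in each single length. Since \<open>kirch_insert\<close> does
  not require \<open>e\<close> to join two different vertices, this also covers loops, which a
  series reduction can create.\<close>

lemma kirch_add_len:
  assumes "finite E" "e \<in> E"
  shows "kirch V ends (len(e := a + b)) E = a * kirch V ends len (E - {e}) + kirch V ends (len(e := b)) E"
proof -
  define F where "F = E - {e}"
  have F: "E = insert e F" "e \<notin> F" "finite F" using assms by (auto simp: F_def)
  have 1: "kirch V ends (len(e := c)) F = kirch V ends len F" for c
    using F(2) by (intro kirch_cong) auto
  have 2: "(\<Prod>f\<in>F - T. (len(e := c)) f) = (\<Prod>f\<in>F - T. len f)" for T c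
    using F(2) by (intro prod.cong) auto
  show ?thesis
    unfolding F_def[symmetric] unfolding F(1) kirch_insert[OF F(3,2)] 1 2
    by (simp add: algebra_simps)
qed

text \<open>No other edge leaves \<open>v\<close>, so every spanning tree uses \<open>e\<close> and
  the deletion term vanishes. Loops at \<open>v\<close> are allowed.\<close>

lemma kirch_leaf:
  assumes "multigraph V ends E" "e \<in> E" "ends e = {u, v}" "u \<noteq> v" "u \<in> V" "v \<in> V"
    and "\<And>f. f \<in> E - {e} \<Longrightarrow> v \<in> ends f \<Longrightarrow> ends f = {v}"
  shows "kirch V ends len E = kirch (V - {v}) (contract u v ends) len (E - {e})"
proof -
  have "V \<noteq> {v}" using assms(4,5) by blast
  hence "\<not> linked V ends (E - {e})" by (rule isolated_not_linked[OF assms(6) _ assms(7)])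
  moreover have "insert e (E - {e}) = E" using assms(2) by blast
  ultimately show ?thesis
    using kirch_insert_nonloop[of "E - {e}" e V ends u v len] kirch_unlinked[of V ends "E - {e}" len]
      assms by (simp add: multigraph_def)
qed

text \<open>After deleting \<open>e\<close>, the edge \<open>e'\<close> is a leaf; contracting it
  gives the same graph as contracting \<open>e\<close>, since nothing else meets \<open>v\<close>.
  The deletion term is thus \<open>len e\<close> times the slope of the contraction term in the
  length of \<open>e'\<close>, and adding it lengthens \<open>e'\<close> by \<open>len e\<close>.
  For \<open>x = y\<close> the merged edge is a loop.\<close>

lemma kirch_series:
  assumes "multigraph V ends E" "e \<in> E" "e' \<in> E" "e \<noteq> e'"
    and "ends e = {x, v}" "x \<noteq> v" "x \<in> V" "v \<in> V" "ends e' = {y, v}" "y \<noteq> v" "y \<in> V"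
    and "\<And>f. f \<in> E - {e, e'} \<Longrightarrow> v \<notin> ends f"
  shows "kirch V ends len E =
    kirch (V - {v}) (contract x v ends) (len(e' := len e + len e')) (E - {e})"
proof -
  have fin: "finite V" "finite E" using assms(1) by (auto simp: multigraph_def)
  have E: "E = insert e (E - {e})" using assms(2) by blast
  have "kirch V ends len E = len e * kirch V ends len (E - {e}) +
      kirch (V - {v}) (contract x v ends) len (E - {e})"
    using kirch_insert_nonloop[where ?ends = ends, OF _ _ fin(1) assms(5-8), of "E - {e}" len] fin E by simp
  also have "kirch V ends len (E - {e}) = kirch (V - {v}) (contract y v ends) len (E - {e} - {e'})"
    using assms by (intro kirch_leaf multigraph_subset[OF assms(1)]) auto
  also have "\<dots> = kirch (V - {v}) (contract x v ends) len (E - {e} - {e'})"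
  proof (rule kirch_cong)
    fix f assume "f \<in> E - {e} - {e'}"
    hence "v \<notin> ends f" using assms(12) by blast
    thus "merge y v ` ends f = merge x v ` ends f"
      by (intro image_cong) (auto simp: merge_def)
  qed simp
  finally show ?thesis
    using kirch_add_len[of "E - {e}" e' "V - {v}" "contract x v ends" len "len e" "len e'"]
      fin assms(3,4) by simp
qed

lemma sum_inc_card:
  assumes "finite V" "finite E" "\<And>e. e \<in> E \<Longrightarrow> ends e \<subseteq> V"
  shows "(\<Sum>v\<in>V. card {e \<in> E. v \<in> ends e}) = (\<Sum>e\<in>E. card (ends e))"
proof -
  have "(\<Sum>v\<in>V. card {e \<in> E. v \<in> ends e}) = (\<Sum>v\<in>V. \<Sum>e | e \<in> E \<and> v \<in> ends e. 1)" by simp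
  also have "\<dots> = (\<Sum>e\<in>E. \<Sum>v | v \<in> V \<and> v \<in> ends e. 1)"
    by (rule sum.swap_restrict[OF assms(1,2)])
  also have "\<dots> = (\<Sum>e\<in>E. card (ends e))"
  proof (rule sum.cong[OF refl])
    fix e assume "e \<in> E"
    hence "{v. v \<in> V \<and> v \<in> ends e} = ends e" using assms(3) by blast
    thus "(\<Sum>v | v \<in> V \<and> v \<in> ends e. 1) = card (ends e)" by simp
  qed
  finally show ?thesis .
qed

text \<open>Two nested inductions: Euler's identity lowers the Betti number, while a leaf or series
  reduction keeps it, lowers the number of vertices and never increases the total length.\<close>

theorem kirch_bound:
  assumes "multigraph V ends E" "\<And>e. e \<in> E \<Longrightarrow> 0 \<le> len e" "card E + 1 = card V + k"
  shows "kirch V ends len E \<le> tree_const k * sum len E ^ k"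
  using assms
proof (induction k arbitrary: V ends E len)
  case 0
  hence fE: "finite E" by (simp add: multigraph_def)
  have "{T. T \<subseteq> E \<and> tree_set V ends T} \<subseteq> {E}"
  proof
    fix T assume "T \<in> {T. T \<subseteq> E \<and> tree_set V ends T}"
    hence T: "T \<subseteq> E" "card T = card E" using 0(3) by (auto simp: tree_set_def)
    thus "T \<in> {E}" using card_subset_eq[OF fE T] by simp
  qed
  hence "kirch V ends len E \<le> (\<Sum>T\<in>{E}. \<Prod>e\<in>E - T. len e)"
    unfolding kirch_def by (intro sum_mono2) auto
  thus ?case by simp
next
  case (Suc k)
  note outer = Suc.IH
  from Suc.prems show ?case
  proof (induction "card V" arbitrary: V ends E len rule: less_induct)
    case less
    note mg = less.prems(1) and nn = less.prems(2) and cd = less.prems(3)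
    have fin: "finite V" "finite E" using mg by (auto simp: multigraph_def)
    let ?L = "sum len E"
    \<comment> \<open>Shared by both reductions: one vertex and one edge disappear, so the Betti
      number stays \<open>Suc k\<close> and only the inner induction is used.\<close>
    have reduce: ?case
      if red: "kirch V ends len E = kirch (V - {v}) (contract u v ends) len' (E - {e})"
        and uv: "u \<in> V" "v \<in> V" "u \<noteq> v" "e \<in> E"
        and nn': "\<And>f. f \<in> E - {e} \<Longrightarrow> 0 \<le> len' f" and L': "sum len' (E - {e}) \<le> ?L"
      for u v len' e
    proof -
      have "card (V - {v}) < card V" using uv fin by (metis card_Diff1_less)
      moreover have "multigraph (V - {v}) (contract u v ends) (E - {e})"
        using multigraph_contract[OF multigraph_subset[OF mg] uv(1,3)] by blast
      moreover have "card (E - {e}) + 1 = card (V - {v}) + Suc k"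
      proof -
        have "card E = Suc (card (E - {e}))" "card V = Suc (card (V - {v}))"
          using uv fin by (metis card_Suc_Diff1)+
        thus ?thesis using cd by simp
      qed
      ultimately have "kirch V ends len E \<le> tree_const (Suc k) * sum len' (E - {e}) ^ Suc k"
        unfolding red by (intro less.hyps nn') auto
      also have "\<dots> \<le> tree_const (Suc k) * ?L ^ Suc k"
        using L' nn' by (intro mult_left_mono tree_const_nonneg power_mono sum_nonneg) auto
      finally show ?thesis .
    qed
    have tot: "sum len (E - {e}) = ?L - len e" if "e \<in> E" for e
      using sum_diff1[OF fin(2), of len e] that by simp
    have euler: "(real k + 1) * kirch V ends len E \<le>
        tree_const k * (\<Sum>e\<in>E. len e * (?L - len e) ^ k)"
    proof -
      have "(real k + 1) * kirch V ends len E = (\<Sum>e\<in>E. len e * kirch V ends len (E - {e}))"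
        using kirch_euler[OF fin(2) cd, of ends len] by (simp add: algebra_simps)
      also have "\<dots> \<le> (\<Sum>e\<in>E. len e * (tree_const k * (?L - len e) ^ k))"
      proof (intro sum_mono mult_left_mono nn)
        fix e assume e: "e \<in> E"
        have "card (E - {e}) + 1 = card V + k"
          using card_Suc_Diff1[OF fin(2) e] cd by simp
        hence "kirch V ends len (E - {e}) \<le> tree_const k * sum len (E - {e}) ^ k"
          by (intro outer multigraph_subset[OF mg]) (auto intro: nn)
        thus "kirch V ends len (E - {e}) \<le> tree_const k * (?L - len e) ^ k"
          using tot[OF e] by simp
      qed
      finally show ?thesis by (simp add: sum_distrib_left algebra_simps)
    qed
    show ?case
    proof (cases k)
      \<comment> \<open>Betti number 1: all powers in \<open>euler\<close> are 1, so it already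
        bounds the polynomial by the total length, for any number of edges.\<close>
      case 0
      thus ?thesis using euler by (simp add: sum_distrib_left)
    next
      case (Suc j)
      show ?thesis
      \<comment> \<open>The Betti number is \<open>Suc k\<close>, so \<open>3 * k\<close> is three
        times the Betti number minus three.\<close>
      proof (cases "card E \<le> 3 * k")
        case True
        have "(real k + 1) * kirch V ends len E \<le>
            tree_const k * ((1 - 1 / (3 * real k)) ^ k * ?L ^ Suc k)"
          using euler mult_left_mono[OF sum_tangent_bound[OF fin(2), of j len] tree_const_nonneg[of k]]
            True nn Suc by fastforce
        thus ?thesis by (simp add: field_simps)
      next
        case False
        have "card V \<noteq> 1" using False cd Suc by auto
        moreover have "\<exists>v\<in>V. card {e \<in> E. v \<in> ends e} \<le> 2"
        proof (rule ccontr)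
          \<comment> \<open>Three edges at every vertex give
            \<open>3 * card V \<le> 2 * card E\<close>; with \<open>card E = card V + k\<close> this
            means \<open>card E \<le> 3 * k\<close>.\<close>
          assume "\<not> ?thesis"
          hence "(\<Sum>v\<in>V. 3) \<le> (\<Sum>v\<in>V. card {e \<in> E. v \<in> ends e})"
            by (intro sum_mono) fastforce
          also have "\<dots> = (\<Sum>e\<in>E. card (ends e))"
            using mg by (intro sum_inc_card) (auto simp: multigraph_def)
          also have "\<dots> \<le> (\<Sum>e\<in>E. 2)" using mg by (intro sum_mono) (auto simp: multigraph_def)
          finally show False using cd False by simp
        qed
        then obtain v where v: "v \<in> V" "card {e \<in> E. v \<in> ends e} \<le> 2" by blast
        have Vv: "V \<noteq> {v}" using \<open>card V \<noteq> 1\<close> by auto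
        show ?thesis
        proof (cases "\<forall>e\<in>E. v \<in> ends e \<longrightarrow> ends e = {v}")
          case True
          have "kirch V ends len E = 0"
            using isolated_not_linked[OF v(1) Vv, of E ends] True by (intro kirch_unlinked) blast
          moreover have "0 \<le> ?L" using nn by (rule sum_nonneg)
          ultimately show ?thesis using tree_const_nonneg[of "Suc k"]
            by (simp del: tree_const.simps power_Suc)
        next
          case False
          then obtain e where e: "e \<in> E" "v \<in> ends e" "ends e \<noteq> {v}" by blast
          obtain x where x: "x \<in> V" "x \<noteq> v" "ends e = {x, v}" using nonloop_ends[OF mg e] .
          show ?thesis
          proof (cases "\<forall>f\<in>E - {e}. v \<in> ends f \<longrightarrow> ends f = {v}")
            case True
            have "kirch V ends len E = kirch (V - {v}) (contract x v ends) len (E - {e})"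
              using True by (intro kirch_leaf[OF mg e(1) x(3,2,1) v(1)]) blast
            thus ?thesis using tot[OF e(1)] nn e(1) by (intro reduce[OF _ x(1) v(1) x(2) e(1)]) auto
          next
            case False
            then obtain e' where e': "e' \<in> E" "e' \<noteq> e" "v \<in> ends e'" "ends e' \<noteq> {v}" by blast
            obtain y where y: "y \<in> V" "y \<noteq> v" "ends e' = {y, v}" using nonloop_ends[OF mg e'(1,3,4)] .
            \<comment> \<open>The two non-loops exhaust the edges at \<open>v\<close>, so
              \<open>v\<close> carries no loop and the series reduction applies.\<close>
            have "{e \<in> E. v \<in> ends e} = {e, e'}"
              using e e' v(2) fin by (intro card_seteq[symmetric]) auto
            hence "\<And>f. f \<in> E - {e, e'} \<Longrightarrow> v \<notin> ends f" by blast
            hence red: "kirch V ends len E =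
                kirch (V - {v}) (contract x v ends) (len(e' := len e + len e')) (E - {e})"
              using e' by (intro kirch_series[OF mg e(1) e'(1) _ x(3,2,1) v(1) y(3,2,1)]) auto
            have "sum (len(e' := len e + len e')) (E - {e}) =
                len e + len e' + sum len (E - {e} - {e'})"
              using e' fin by (subst sum.remove[of _ e']) (auto intro: sum.cong)
            also have "\<dots> = len e + sum len (E - {e})"
              using e' fin by (subst (2) sum.remove[of _ e']) auto
            finally have "sum (len(e' := len e + len e')) (E - {e}) \<le> ?L" using tot[OF e(1)] by simp
            thus ?thesis
              using nn e(1) e'(1) by (intro reduce[OF red x(1) v(1) x(2) e(1)]) auto
          qed
        qed
      qed
    qed
  qed
qed

section \<open>The matrix-tree theorem\<close>

text \<open>The list \<open>vs\<close> will omit a root, so this is the reduced Laplacian. Loops are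
  left out of the diagonal because contractions create them and no spanning tree contains
  them.\<close>

definition laplacian :: "('e \<Rightarrow> 'v set) \<Rightarrow> 'e set \<Rightarrow> 'v list \<Rightarrow> real mat" where
  "laplacian ends E vs = mat (length vs) (length vs) (\<lambda>(i, j).
     if i = j then real (card {e \<in> E. vs ! i \<in> ends e \<and> ends e \<noteq> {vs ! i}})
     else - real (card {e \<in> E. ends e = {vs ! i, vs ! j}}))"

lemma laplacian_carrier: "laplacian ends E vs \<in> carrier_mat (length vs) (length vs)"
  by (simp add: laplacian_def)

text \<open>No edge leads from \<open>vs\<close> to the root, so every row sums to zero and the
  all-ones vector, nonzero as \<open>vs\<close> is nonempty, lies in the kernel.\<close>

lemma det_laplacian_isolated_root:
  assumes "multigraph (insert r (set vs)) ends E" "distinct (r # vs)" "vs \<noteq> []"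
    and "\<And>e. e \<in> E \<Longrightarrow> r \<in> ends e \<Longrightarrow> ends e = {r}"
  shows "det (laplacian ends E vs) = 0"
proof -
  let ?n = "length vs" and ?A = "laplacian ends E vs" and ?v = "vec (length vs) (\<lambda>_. 1 :: real)"
  have row: "(\<Sum>j<?n. ?A $$ (i, j)) = 0" if i: "i < ?n" for i
  proof -
    let ?S = "\<lambda>j. {e \<in> E. ends e = {vs ! i, vs ! j}}"
    have fE: "finite E" using assms(1) by (simp add: multigraph_def)
    have "{e \<in> E. vs ! i \<in> ends e \<and> ends e \<noteq> {vs ! i}} = (\<Union>j\<in>{..<?n} - {i}. ?S j)"
    proof (intro equalityI subsetI)
      fix e assume "e \<in> {e \<in> E. vs ! i \<in> ends e \<and> ends e \<noteq> {vs ! i}}"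
      hence e: "e \<in> E" "vs ! i \<in> ends e" "ends e \<noteq> {vs ! i}" by auto
      obtain u where u: "u \<in> insert r (set vs)" "u \<noteq> vs ! i" "ends e = {u, vs ! i}"
        using nonloop_ends[OF assms(1) e] .
      have "u \<noteq> r" using assms(4)[OF e(1)] u by auto
      then obtain j where "j < ?n" "u = vs ! j" using u(1) by (auto simp: in_set_conv_nth)
      thus "e \<in> (\<Union>j\<in>{..<?n} - {i}. ?S j)" using e(1) u by auto
    next
      fix e assume "e \<in> (\<Union>j\<in>{..<?n} - {i}. ?S j)"
      then obtain j where j: "j < ?n" "j \<noteq> i" "e \<in> E" "ends e = {vs ! i, vs ! j}" by blast
      hence "vs ! i \<noteq> vs ! j" using assms(2) i by (simp add: nth_eq_iff_index_eq)
      thus "e \<in> {e \<in> E. vs ! i \<in> ends e \<and> ends e \<noteq> {vs ! i}}" using j by auto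
    qed
    hence "card {e \<in> E. vs ! i \<in> ends e \<and> ends e \<noteq> {vs ! i}} = (\<Sum>j\<in>{..<?n} - {i}. card (?S j))"
    proof (simp only:, intro card_UN_disjoint)
      show "\<forall>j\<in>{..<?n} - {i}. \<forall>j'\<in>{..<?n} - {i}. j \<noteq> j' \<longrightarrow> ?S j \<inter> ?S j' = {}"
        using assms(2) i by (auto simp: doubleton_eq_iff nth_eq_iff_index_eq)
    qed (use fE in auto)
    moreover have "(\<Sum>j<?n. ?A $$ (i, j)) = ?A $$ (i, i) + (\<Sum>j\<in>{..<?n} - {i}. ?A $$ (i, j))"
      using i by (intro sum.remove) auto
    moreover have "(\<Sum>j\<in>{..<?n} - {i}. ?A $$ (i, j)) = (\<Sum>j\<in>{..<?n} - {i}. - real (card (?S j)))"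
      using i by (intro sum.cong) (auto simp: laplacian_def)
    ultimately show ?thesis using i by (simp add: laplacian_def sum_negf)
  qed
  have "?A *\<^sub>v ?v = 0\<^sub>v ?n"
    using row by (intro eq_vecI)
      (auto simp: scalar_prod_def lessThan_atLeast0 laplacian_carrier[THEN carrier_matD(1)]
        laplacian_carrier[THEN carrier_matD(2)])
  moreover have "?v \<noteq> 0\<^sub>v ?n"
    using assms(3) by (metis index_vec index_zero_vec(1) length_greater_0_conv zero_neq_one)
  ultimately show ?thesis
    using det_0_iff_vec_prod_zero[OF laplacian_carrier[of ends E vs]] vec_carrier by blast
qed

text \<open>Deleting and contracting an edge at the root \<open>r\<close> expands the determinant along one row.\<close>

theorem matrix_tree:
  assumes "multigraph (insert r (set vs)) ends E" "distinct (r # vs)"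
  shows "det (laplacian ends E vs) = kirch (insert r (set vs)) ends (\<lambda>_. 1) E"
  using assms
proof (induction "card E" arbitrary: ends E vs rule: less_induct)
  case less
  note mg = less.prems(1) and dist = less.prems(2)
  have fE: "finite E" using mg by (simp add: multigraph_def)
  let ?V = "insert r (set vs)"
  show ?case
  proof (cases "\<forall>e\<in>E. r \<in> ends e \<longrightarrow> ends e = {r}")
    case True
    show ?thesis
    proof (cases "vs = []")
      case True
      have "tree_set {r} ends T \<longleftrightarrow> T = {}" for T by (auto simp: tree_set_def linked_def)
      hence "{T. T \<subseteq> E \<and> tree_set {r} ends T} = {{}}" by auto
      hence "kirch ?V ends (\<lambda>_. 1) E = 1" using True by (simp add: kirch_def)
      thus ?thesis using True laplacian_carrier[of ends E vs] by simp
    next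
      case False
      have "?V \<noteq> {r}" using False dist by (cases vs) auto
      hence "kirch ?V ends (\<lambda>_. 1) E = 0"
        using isolated_not_linked[of r ?V E ends] True by (intro kirch_unlinked) blast
      thus ?thesis using det_laplacian_isolated_root[OF mg dist False] True by simp
    qed
  next
    case False
    then obtain e where e: "e \<in> E" "r \<in> ends e" "ends e \<noteq> {r}" by blast
    obtain u where u: "u \<in> ?V" "u \<noteq> r" "ends e = {u, r}" using nonloop_ends[OF mg e] .
    then obtain i where i: "i < length vs" "u = vs ! i" by (auto simp: in_set_conv_nth)
    define E' where "E' = E - {e}"
    define vs' where "vs' = take i vs @ drop (Suc i) vs"
    let ?n = "length vs" and ?c = "contract r u ends"
    let ?A = "laplacian ends E vs" and ?B = "laplacian ends E' vs"
    have E: "E = insert e E'" "e \<notin> E'" "finite E'" using e fE by (auto simp: E'_def)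
    have mg': "multigraph ?V ends E'" using multigraph_subset[OF mg] by (simp add: E'_def)
    have vs: "vs = take i vs @ u # drop (Suc i) vs" unfolding i(2) by (rule id_take_nth_drop[OF i(1)])
    have dist': "distinct (r # vs')" and notin: "u \<notin> set vs'" and set': "set vs = insert u (set vs')"
    proof -
      have "distinct (take i vs @ u # drop (Suc i) vs)" using dist unfolding vs[symmetric] by simp
      moreover have "set (take i vs @ u # drop (Suc i) vs) = set vs" unfolding vs[symmetric] ..
      ultimately show "distinct (r # vs')" "u \<notin> set vs'" "set vs = insert u (set vs')"
        using dist unfolding vs'_def by auto
    qed
    have V': "?V - {u} = insert r (set vs')" using set' notin u by auto
    have len': "length vs' = ?n - 1" using i by (simp add: vs'_def)
    have nth': "vs' ! j = vs ! (if j < i then j else Suc j)" if "j < length vs'" for j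
      using that i by (auto simp: vs'_def nth_append min_def)
    have k: "kirch ?V ends (\<lambda>_. 1) E =
        kirch ?V ends (\<lambda>_. 1) E' + kirch (?V - {u}) ?c (\<lambda>_. 1) E'"
      using kirch_insert_nonloop[OF E(3,2), where V = ?V and ends = ends and u = r and v = u and
          len = "\<lambda>_. 1"] u E(1) by (simp add: insert_commute)
    have IH1: "det ?B = kirch ?V ends (\<lambda>_. 1) E'"
      using less.hyps[of E' vs ends] mg' dist E by simp
    have mgc: "multigraph (?V - {u}) ?c E'" using u by (intro multigraph_contract[OF mg']) auto
    have IH2: "det (laplacian ?c E' vs') = kirch (?V - {u}) ?c (\<lambda>_. 1) E'"
      using less.hyps[of E' vs' ?c] mgc dist' E unfolding V' by simp
    \<comment> \<open>Contraction merges \<open>u\<close> into the root, which has no row or column.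
      So row and column \<open>i\<close> disappear and all other entries are unchanged.\<close>
    have minor: "mat_delete ?A i i = laplacian ?c E' vs'"
    proof (rule eq_matI)
      show dims: "dim_row (mat_delete ?A i i) = dim_row (laplacian ?c E' vs')"
        "dim_col (mat_delete ?A i i) = dim_col (laplacian ?c E' vs')"
        by (auto simp: laplacian_def len')
      fix a b assume ab: "a < dim_row (laplacian ?c E' vs')" "b < dim_col (laplacian ?c E' vs')"
      define a' b' where "a' = (if a < i then a else Suc a)" and "b' = (if b < i then b else Suc b)"
      have ab': "a < length vs'" "b < length vs'" "a' < ?n" "b' < ?n" "a' \<noteq> i" "b' \<noteq> i"
          "a' = b' \<longleftrightarrow> a = b" "vs' ! a = vs ! a'" "vs' ! b = vs ! b'"
        using ab nth' i len' by (auto simp: laplacian_def a'_def b'_def)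
      have ne: "vs ! a' \<noteq> u" "vs ! b' \<noteq> u" "vs ! a' \<noteq> r" "vs ! b' \<noteq> r"
        using ab' i dist by (auto simp: nth_eq_iff_index_eq)
      have mem: "x \<in> merge r u ` S \<longleftrightarrow> x \<in> S" if "x \<noteq> r" "x \<noteq> u" for x S
        using that by (auto simp: merge_def image_iff)
      have eq: "merge r u ` S = {x, y} \<longleftrightarrow> S = {x, y}"
        if "x \<noteq> r" "x \<noteq> u" "y \<noteq> r" "y \<noteq> u" for x y S
      proof
        assume m: "merge r u ` S = {x, y}"
        have "u \<notin> S" "r \<notin> S" using m that u(2) by (force simp: merge_def)+
        hence "merge r u ` S = S" by (force simp: merge_def)
        thus "S = {x, y}" using m by simp
      next
        assume "S = {x, y}"
        thus "merge r u ` S = {x, y}" using that by (auto simp: merge_def)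
      qed
      have "{f \<in> E. vs ! a' \<in> ends f \<and> ends f \<noteq> {vs ! a'}} =
          {f \<in> E'. vs ! a' \<in> ?c f \<and> ?c f \<noteq> {vs ! a'}}"
        using ne u(3) mem[of "vs ! a'"] eq[of "vs ! a'" "vs ! a'"] unfolding E(1) by auto
      moreover have "{f \<in> E. ends f = {vs ! a', vs ! b'}} = {f \<in> E'. ?c f = {vs ! a', vs ! b'}}"
        using ne u(3) eq[of "vs ! a'" "vs ! b'"] unfolding E(1) by (auto simp: doubleton_eq_iff)
      ultimately have "?A $$ (a', b') = laplacian ?c E' vs' $$ (a, b)"
        using ab' by (cases "a = b") (simp_all add: laplacian_def)
      moreover have "mat_delete ?A i i $$ (a, b) = ?A $$ (a', b')"
        using ab' len' by (simp add: mat_delete_def a'_def b'_def laplacian_carrier[THEN carrier_matD(1)]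
            laplacian_carrier[THEN carrier_matD(2)])
      ultimately show "mat_delete ?A i i $$ (a, b) = laplacian ?c E' vs' $$ (a, b)" by simp
    qed
    \<comment> \<open>The edge \<open>e\<close> joins \<open>u\<close> to the root, so only the
      diagonal entry of \<open>u\<close> counts it.\<close>
    have other: "?A $$ (a, b) = ?B $$ (a, b)" if "a < ?n" "b < ?n" "(a, b) \<noteq> (i, i)" for a b
    proof -
      have r: "r \<noteq> vs ! a" "r \<noteq> vs ! b" using that dist by auto
      have "{f \<in> E. ends f = {vs ! a, vs ! b}} = {f \<in> E'. ends f = {vs ! a, vs ! b}}"
        using r u(3) unfolding E(1) by (auto simp: doubleton_eq_iff)
      moreover have "{f \<in> E. vs ! a \<in> ends f \<and> ends f \<noteq> {vs ! a}} =
          {f \<in> E'. vs ! a \<in> ends f \<and> ends f \<noteq> {vs ! a}}" if "a \<noteq> i"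
        using that r u(3) i dist \<open>a < ?n\<close> unfolding E(1) by (auto simp: nth_eq_iff_index_eq)
      ultimately show ?thesis using that by (auto simp: laplacian_def)
    qed
    have diag: "?A $$ (i, i) = ?B $$ (i, i) + 1"
    proof -
      have "{f \<in> E. vs ! i \<in> ends f \<and> ends f \<noteq> {vs ! i}} =
          insert e {f \<in> E'. vs ! i \<in> ends f \<and> ends f \<noteq> {vs ! i}}"
        using u i unfolding E(1) by auto
      thus ?thesis using i E(2,3) by (simp add: laplacian_def)
    qed
    have cof: "cofactor ?A i j = cofactor ?B i j" if "j < ?n" for j
    proof -
      have "mat_delete ?A i j = mat_delete ?B i j"
        using other that i by (intro eq_matI) (auto simp: mat_delete_def laplacian_def[of _ _ vs, THEN arg_cong[where f = dim_row]] laplacian_def[of _ _ vs, THEN arg_cong[where f = dim_col]])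
      thus ?thesis by (simp add: cofactor_def)
    qed
    have rem: "(\<Sum>j<?n. M $$ (i, j) * cofactor M i j) =
        M $$ (i, i) * cofactor M i i + (\<Sum>j\<in>{..<?n} - {i}. M $$ (i, j) * cofactor M i j)" for M :: "real mat"
      using i by (intro sum.remove) auto
    have "(\<Sum>j\<in>{..<?n} - {i}. ?A $$ (i, j) * cofactor ?A i j) =
        (\<Sum>j\<in>{..<?n} - {i}. ?B $$ (i, j) * cofactor ?B i j)"
      using other cof i by (intro sum.cong) auto
    hence "det ?A = det ?B + cofactor ?A i i"
      unfolding laplace_expansion_row[OF laplacian_carrier i(1)] rem diag
      using cof[OF i(1)] by (simp add: algebra_simps)
    also have "cofactor ?A i i = det (laplacian ?c E' vs')"
      unfolding cofactor_def minor by (simp flip: power2_eq_square mult_2)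
    finally show ?thesis unfolding IH1 IH2 k .
  qed
qed

section \<open>Spanning trees of simple graphs\<close>

lemma mem_edges:
  assumes "pair_graph G"
  shows "{u, v} \<in> edges G \<longleftrightarrow> (u, v) \<in> parcs G"
proof -
  interpret pair_graph G by fact
  show ?thesis using arcs_symmetric by (auto simp: edges_def doubleton_eq_iff)
qed

lemma edgeE:
  assumes "e \<in> edges G"
  obtains u v where "e = {u, v}" "(u, v) \<in> parcs G"
  using assms by (auto simp: edges_def)

lemma multigraph_edges:
  assumes "pair_graph G"
  shows "multigraph (pverts G) (\<lambda>e. e) (edges G)"
proof -
  interpret pair_graph G by fact
  have "edges G = (\<lambda>(u, v). {u, v}) ` parcs G" by (auto simp: edges_def)
  hence "finite (edges G)" using pair_finite_arcs by simp
  moreover have "e \<subseteq> pverts G \<and> e \<noteq> {} \<and> card e \<le> 2" if "e \<in> edges G" for e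
    using that
  proof (rule edgeE)
    fix u v assume "e = {u, v}" "(u, v) \<in> parcs G"
    thus ?thesis using wellformed'[of u v] by (auto simp: card_insert_if)
  qed
  ultimately show ?thesis using pair_finite_verts by (simp add: multigraph_def)
qed

lemma pair_graph_del_edges:
  assumes "pair_graph G"
  shows "pair_graph (del_edges G S)"
proof -
  interpret pair_graph G by fact
  show ?thesis
  proof
    show "symmetric (with_proj (del_edges G S))"
      unfolding symmetric_def using arcs_symmetric
      by (intro symI) (auto simp: del_edges_def doubleton_eq_iff insert_commute)
    show "finite (parcs (del_edges G S))"
      using pair_finite_arcs by (rule rev_finite_subset) (auto simp: del_edges_def)
  qed (use wellformed' no_loops' pair_finite_verts in \<open>auto simp: del_edges_def\<close>)
qed

lemma edges_del_edges: "edges (del_edges G S) = edges G - S"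
  by (auto simp: edges_def del_edges_def)

text \<open>In a symmetric digraph connected means strongly connected. A walk from inside
  \<open>X\<close> to outside crosses its boundary; conversely, no edge leaves the set of vertices
  reachable from \<open>u\<close>.\<close>

lemma connected_iff_linked:
  assumes "pair_graph G"
  shows "connected (with_proj G) \<longleftrightarrow> linked (pverts G) (\<lambda>e. e) (edges G)"
proof -
  interpret pair_graph G by fact
  have "mk_symmetric (with_proj G) = G"
    unfolding mk_symmetric_def using arcs_symmetric by (intro pair_pre_digraph.equality) auto
  hence "connected (with_proj G) \<longleftrightarrow> strongly_connected (with_proj G)"
    by (simp add: connected_def)
  also have "\<dots> \<longleftrightarrow> linked (pverts G) (\<lambda>e. e) (edges G)"
  proof
    assume L: "strongly_connected (with_proj G)"
    show "linked (pverts G) (\<lambda>e. e) (edges G)"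
      unfolding linked_def
    proof (intro conjI allI impI)
      show "pverts G \<noteq> {}" using L by (simp add: strongly_connected_def)
      fix X assume X: "X \<subseteq> pverts G \<and> X \<noteq> {} \<and> X \<noteq> pverts G"
      then obtain u v where uv: "u \<in> X" "v \<in> pverts G" "v \<notin> X" "u \<in> pverts G" by blast
      have "u \<rightarrow>\<^sup>*\<^bsub>with_proj G\<^esub> v" using L uv by (simp add: strongly_connected_def)
      hence "v \<notin> X \<Longrightarrow> \<exists>x y. (x, y) \<in> parcs G \<and> x \<in> X \<and> y \<notin> X"
      proof (induction rule: reachable_induct)
        case base
        thus ?case using uv(1) by blast
      next
        case (step x y)
        thus ?case by (cases "x \<in> X") auto
      qed
      then obtain x y where "(x, y) \<in> parcs G" "x \<in> X" "y \<notin> X" using uv by blast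
      thus "\<exists>e\<in>edges G. e \<inter> X \<noteq> {} \<and> e - X \<noteq> {}"
        using mem_edges[OF assms, of x y] by (intro bexI[of _ "{x, y}"]) auto
    qed
  next
    assume L: "linked (pverts G) (\<lambda>e. e) (edges G)"
    show "strongly_connected (with_proj G)"
      unfolding strongly_connected_def
    proof (intro conjI ballI)
      show "verts (with_proj G) \<noteq> {}" using L by (simp add: linked_def)
      fix u v assume uv: "u \<in> verts (with_proj G)" "v \<in> verts (with_proj G)"
      define X where "X = {w. u \<rightarrow>\<^sup>*\<^bsub>with_proj G\<^esub> w}"
      have X: "X \<subseteq> pverts G" "X \<noteq> {}"
        using uv reachable_in_verts by (auto simp: X_def)
      have "X = pverts G"
      proof (rule ccontr)
        assume "X \<noteq> pverts G"
        then obtain e where e: "e \<in> edges G" "e \<inter> X \<noteq> {}" "e - X \<noteq> {}"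
          using L X unfolding linked_def by blast
        then obtain x y where xy: "e = {x, y}" "x \<in> X" "y \<notin> X"
          by (elim edgeE) blast
        have "(x, y) \<in> parcs G" using e(1) mem_edges[OF assms] xy(1) by simp
        moreover have "u \<rightarrow>\<^sup>*\<^bsub>with_proj G\<^esub> x" using xy(2) by (simp add: X_def)
        ultimately have "u \<rightarrow>\<^sup>*\<^bsub>with_proj G\<^esub> y" using reachable_adj_trans by simp
        hence "y \<in> X" by (simp add: X_def)
        thus False using xy by simp
      qed
      thus "u \<rightarrow>\<^sup>*\<^bsub>with_proj G\<^esub> v" using uv by (auto simp: X_def)
    qed
  qed
  finally show ?thesis .
qed

text \<open>Applied to the rest of a cycle, this replaces a removed edge of the cycle wherever that
  edge crossed a vertex set.\<close>

lemma pcas_crosses: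
  assumes "pcas a p b" "a \<in> X \<longleftrightarrow> b \<notin> X"
  shows "\<exists>(x, y)\<in>set p. x \<in> X \<longleftrightarrow> y \<notin> X"
  using assms
proof (induction p arbitrary: a)
  case (Cons e p)
  obtain x y where e: "e = (x, y)" by (cases e)
  show ?case
  proof (cases "x \<in> X \<longleftrightarrow> y \<in> X")
    case True
    hence "\<exists>(x, y)\<in>set p. x \<in> X \<longleftrightarrow> y \<notin> X" using Cons e by (intro Cons.IH[of y]) auto
    thus ?thesis by auto
  next
    case False
    thus ?thesis using e by auto
  qed
qed simp

lemma undirected_tree_iff:
  assumes "pair_graph T"
  shows "undirected_tree T \<longleftrightarrow> tree_set (pverts T) (\<lambda>e. e) (edges T)"
proof
  interpret pair_graph T by fact
  assume U: "undirected_tree T"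
  have "linked (pverts T) (\<lambda>e. e) (edges T)"
    using U connected_iff_linked[OF assms] by (simp add: undirected_tree_def)
  then obtain F where F: "F \<subseteq> edges T" "tree_set (pverts T) (\<lambda>e. e) F"
    using tree_set_exists[OF multigraph_edges[OF assms]] by blast
  have "F = edges T"
  proof (rule ccontr)
    assume "F \<noteq> edges T"
    then obtain e where e: "e \<in> edges T" "e \<notin> F" using F(1) by blast
    then obtain u v where uv: "e = {u, v}" "(u, v) \<in> parcs T" by (elim edgeE)
    define T' where "T' = del_edges T {e}"
    interpret T': pair_graph T' unfolding T'_def by (rule pair_graph_del_edges[OF assms])
    have V': "pverts T' = pverts T" and sub: "parcs T' \<subseteq> parcs T" and vu: "(v, u) \<notin> parcs T'"
      by (auto simp: T'_def del_edges_def uv insert_commute)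
    have "F \<subseteq> edges T'" using F e by (auto simp: T'_def edges_del_edges)
    hence "linked (pverts T') (\<lambda>e. e) (edges T')"
      using F(2) linked_mono unfolding V' by (auto simp: tree_set_def)
    hence "strongly_connected (with_proj (mk_symmetric (with_proj T')))"
      using connected_iff_linked[OF T'.pair_graph] by (simp add: connected_def)
    hence "v \<rightarrow>\<^sup>*\<^bsub>with_proj (mk_symmetric (with_proj T'))\<^esub> u"
      using wellformed'[OF uv(2)] V' by (simp add: strongly_connected_def mk_symmetric_def)
    hence "v \<rightarrow>\<^sup>*\<^bsub>with_proj T'\<^esub> u"
      using T'.reachable_mk_symmetric_eq T'.sym_arcs by simp
    then obtain p where p: "T'.apath v p u" using T'.reachable_apath by blast
    have vneu: "v \<noteq> u" using no_loops'[OF uv(2)] by simp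
    \<comment> \<open>The arc from \<open>v\<close> to \<open>u\<close> was deleted together with
      its reverse, so the path has an inner vertex and the closed cycle has length at least 3, as
      the definition of trees demands.\<close>
    have p2: "length p \<ge> 2"
    proof (cases p)
      case Nil
      thus ?thesis using p vneu by (simp add: T'.apath_def T'.awalk_def)
    next
      case (Cons a q)
      thus ?thesis using p vu by (cases q) (auto simp: T'.apath_def T'.awalk_def)
    qed
    have "awalk u ((u, v) # p) u"
      using p uv(2) sub wellformed'[OF uv(2)] V' by (auto simp: T'.apath_def T'.awalk_def awalk_def)
    moreover have "distinct (pawalk_verts v p)" using p by (simp add: T'.apath_def)
    ultimately have "cycle ((u, v) # p)" unfolding cycle_def by auto
    thus False using U p2 by (auto simp: undirected_tree_def)
  qed
  thus "tree_set (pverts T) (\<lambda>e. e) (edges T)" using F(2) by simp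
next
  interpret pair_graph T by fact
  assume T: "tree_set (pverts T) (\<lambda>e. e) (edges T)"
  have "\<not> (cycle p \<and> length p \<ge> 3)" for p
  proof
    assume "cycle p \<and> length p \<ge> 3"
    then obtain u where u: "awalk u p u" "distinct (tl (pawalk_verts u p))" "length p \<ge> 3"
      unfolding cycle_def by blast
    then obtain v w q where p: "p = (u, v) # (v, w) # q" "q \<noteq> []"
      by (cases p; cases "tl p"; cases "tl (tl p)") (auto simp: awalk_def)
    have arcs: "(u, v) \<in> parcs T" "set ((v, w) # q) \<subseteq> parcs T" "pcas v ((v, w) # q) u" "pcas w q u"
      using u(1) p by (auto simp: awalk_def)
    have dist: "v \<notin> set (pawalk_verts w q)" "distinct (pawalk_verts w q)"
      using u(2) p by auto
    have verts: "x \<in> set (pawalk_verts a r) \<and> y \<in> set (pawalk_verts a r)"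
      if "pcas a r b" "(x, y) \<in> set r" for a r b x y
      using that
    proof (induction r arbitrary: a)
      case (Cons e r)
      thus ?case by (cases r) auto
    qed simp
    have last: "b \<in> set (pawalk_verts a r)" if "pcas a r b" for a r b
      using that by (induction r arbitrary: a) auto
    \<comment> \<open>Here length at least 3 matters: as \<open>q\<close> is nonempty,
      \<open>w = u\<close> would repeat a vertex. Hence the rest of the cycle does not just run back
      along the edge between \<open>u\<close> and \<open>v\<close>.\<close>
    have "w \<noteq> u"
    proof
      assume "w = u"
      obtain a q' where "q = a # q'" using p(2) by (cases q) auto
      thus False using dist(2) arcs(4) last[of "snd a" q' u] \<open>w = u\<close> by auto
    qed
    have ne: "{x, y} \<noteq> {u, v}" if "(x, y) \<in> set ((v, w) # q)" for x y
    proof (cases "(x, y) = (v, w)")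
      case True
      thus ?thesis using \<open>w \<noteq> u\<close> by (auto simp: doubleton_eq_iff)
    next
      case False
      hence "(x, y) \<in> set q" using that by auto
      hence "x \<noteq> v" "y \<noteq> v" using verts[OF arcs(4)] dist(1) by blast+
      thus ?thesis by (auto simp: doubleton_eq_iff)
    qed
    have "linked (pverts T) (\<lambda>e. e) (edges T - {{u, v}})"
      unfolding linked_def
    proof (intro conjI allI impI)
      show "pverts T \<noteq> {}" using T by (simp add: tree_set_def linked_def)
      fix X assume X: "X \<subseteq> pverts T \<and> X \<noteq> {} \<and> X \<noteq> pverts T"
      then obtain e where e: "e \<in> edges T" "e \<inter> X \<noteq> {}" "e - X \<noteq> {}"
        using T unfolding tree_set_def linked_def by blast
      show "\<exists>e\<in>edges T - {{u, v}}. e \<inter> X \<noteq> {} \<and> e - X \<noteq> {}"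
      proof (cases "e = {u, v}")
        case True
        hence "v \<in> X \<longleftrightarrow> u \<notin> X" using e by auto
        then obtain x y where xy: "(x, y) \<in> set ((v, w) # q)" "x \<in> X \<longleftrightarrow> y \<notin> X"
          using pcas_crosses[OF arcs(3), of X] by blast
        have "{x, y} \<in> edges T" using xy(1) arcs(2) mem_edges[OF assms] by blast
        moreover have "{x, y} \<inter> X \<noteq> {}" "{x, y} - X \<noteq> {}" using xy(2) by auto
        ultimately show ?thesis using ne[OF xy(1)] by (intro bexI[of _ "{x, y}"]) simp_all
      qed (use e in blast)
    qed
    moreover have "{u, v} \<in> edges T" using arcs(1) mem_edges[OF assms] by simp
    ultimately show False using tree_set_minimal[OF multigraph_edges[OF assms] T] by simp
  qed
  thus "undirected_tree T"
    using T assms connected_iff_linked[OF assms] by (simp add: undirected_tree_def tree_set_def)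
qed

text \<open>A symmetric digraph with given vertices is determined by its set of edges, and the tree
  with edge set \<open>F\<close> is recovered by deleting all other edges.\<close>

lemma complexity_eq_card:
  assumes "pair_graph G"
  shows "complexity G = card {F. F \<subseteq> edges G \<and> tree_set (pverts G) (\<lambda>e. e) F}"
proof -
  interpret pair_graph G by fact
  let ?A = "{T :: 'a pair_pre_digraph. undirected_tree T \<and> spanning (with_proj T) (with_proj G)}"
  let ?B = "{F. F \<subseteq> edges G \<and> tree_set (pverts G) (\<lambda>e. e) F}"
  have A: "pair_graph T" "pverts T = pverts G" "parcs T \<subseteq> parcs G" if "T \<in> ?A" for T
    using that by (auto simp: undirected_tree_def spanning_def subgraph_def)
  have "bij_betw edges ?A ?B"
  proof (rule bij_betw_imageI)
    show "inj_on edges ?A"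
    proof (rule inj_onI)
      fix T T' assume T: "T \<in> ?A" "T' \<in> ?A" "edges T = edges T'"
      have "(u, v) \<in> parcs T \<longleftrightarrow> (u, v) \<in> parcs T'" for u v
        using mem_edges[OF A(1)[OF T(1)], of u v] mem_edges[OF A(1)[OF T(2)], of u v] T(3) by simp
      hence "parcs T = parcs T'" by auto
      thus "T = T'" using A(2)[OF T(1)] A(2)[OF T(2)] by simp
    qed
    show "edges ` ?A = ?B"
    proof (intro equalityI subsetI)
      fix F assume "F \<in> edges ` ?A"
      then obtain T where T: "T \<in> ?A" "F = edges T" by blast
      have "undirected_tree T" using T by simp
      thus "F \<in> ?B"
        using undirected_tree_iff[OF A(1)[OF T(1)]] A(2,3)[OF T(1)] T(2) by (auto simp: edges_def)
    next
      fix F assume F: "F \<in> ?B"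
      define T where "T = del_edges G (edges G - F)"
      have pg: "pair_graph T" unfolding T_def by (rule pair_graph_del_edges[OF assms])
      have T: "edges T = F" "pverts T = pverts G" "parcs T \<subseteq> parcs G"
        using F by (auto simp: T_def edges_del_edges) (auto simp: del_edges_def)
      have "undirected_tree T" using undirected_tree_iff[OF pg] T F by simp
      moreover have "spanning (with_proj T) (with_proj G)"
        using T pg assms by (auto simp: spanning_def subgraph_def compatible_def wf_digraph_wp_iff
            pair_graph_def pair_digraph_def pair_fin_digraph_def)
      ultimately show "F \<in> edges ` ?A" using T(1) by blast
    qed
  qed
  thus ?thesis unfolding complexity_def by (rule bij_betw_same_card)
qed

section \<open>Small edge cuts\<close>

definition num_trees :: "'v set \<Rightarrow> ('e \<Rightarrow> 'v set) \<Rightarrow> 'e set \<Rightarrow> nat" where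
  "num_trees V ends E = card {T. T \<subseteq> E \<and> tree_set V ends T}"

lemma num_trees_eq_kirch: "real (num_trees V ends E) = kirch V ends (\<lambda>_. 1) E"
  by (simp add: num_trees_def kirch_def)

definition tree_bound :: "nat \<Rightarrow> nat \<Rightarrow> real" where
  "tree_bound k m = tree_const k * real m ^ k"

lemma tree_bound_nonneg: "0 \<le> tree_bound k m"
  by (simp add: tree_bound_def tree_const_nonneg)

lemma num_trees_bound:
  assumes "multigraph V ends E" "card E + 1 = card V + k"
  shows "real (num_trees V ends E) \<le> tree_bound k (card E)"
  using kirch_bound[OF assms(1) _ assms(2), of "\<lambda>_. 1"]
  by (simp add: num_trees_eq_kirch tree_bound_def)

lemma not_linkedE:
  assumes "\<not> linked V ends T" "V \<noteq> {}"
  obtains Y where "Y \<subseteq> V" "Y \<noteq> {}" "Y \<noteq> V" "\<forall>e\<in>T. ends e \<inter> Y = {} \<or> ends e \<subseteq> Y"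
proof -
  obtain Y where Y: "Y \<subseteq> V" "Y \<noteq> {}" "Y \<noteq> V" "\<not> (\<exists>e\<in>T. ends e \<inter> Y \<noteq> {} \<and> ends e - Y \<noteq> {})"
    using assms unfolding linked_def by blast
  hence "\<forall>e\<in>T. ends e \<inter> Y = {} \<or> ends e \<subseteq> Y" by blast
  thus thesis by (rule that[OF Y(1-3)])
qed

lemma linked_restrict:
  assumes "linked V ends T" "X \<subseteq> V" "X \<noteq> {}" "\<And>e. e \<in> T \<Longrightarrow> ends e \<subseteq> V"
    and "\<And>e. e \<in> T \<Longrightarrow> \<not> ends e \<subseteq> X \<Longrightarrow> f ` (ends e \<inter> X) \<subseteq> {c}"
  shows "linked (f ` X) (\<lambda>e. f ` ends e) {e \<in> T. ends e \<subseteq> X}"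
  unfolding linked_def
proof (intro conjI allI impI)
  show "f ` X \<noteq> {}" using assms(3) by simp
  fix Y assume Y: "Y \<subseteq> f ` X \<and> Y \<noteq> {} \<and> Y \<noteq> f ` X"
  define Y' where "Y' = {x \<in> X. f x \<in> Y}"
  \<comment> \<open>All of \<open>V - X\<close> is put on the side of \<open>c\<close>, so that an
    edge not contained in \<open>X\<close> never crosses \<open>Z\<close>.\<close>
  define Z where "Z = (if c \<in> Y then Y' \<union> (V - X) else Y')"
  obtain x y where "x \<in> X" "f x \<in> Y" "y \<in> X" "f y \<notin> Y" using Y by blast
  hence "Z \<subseteq> V" "x \<in> Z" "y \<in> V" "y \<notin> Z" using assms(2) by (auto simp: Z_def Y'_def)
  then obtain e where e: "e \<in> T" "ends e \<inter> Z \<noteq> {}" "ends e - Z \<noteq> {}"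
    using assms(1) unfolding linked_def by (metis empty_iff)
  then obtain x y where xy: "x \<in> ends e" "x \<in> Z" "y \<in> ends e" "y \<notin> Z" by blast
  have yV: "y \<in> V" using xy(3) assms(4)[OF e(1)] by blast
  have sub: "ends e \<subseteq> X"
  proof (rule ccontr)
    assume "\<not> ends e \<subseteq> X"
    hence c: "z \<in> ends e \<Longrightarrow> z \<in> X \<Longrightarrow> f z = c" for z using assms(5)[OF e(1)] by blast
    show False
    proof (cases "c \<in> Y")
      case True
      hence "y \<in> X" "f y \<notin> Y" using xy(4) yV by (auto simp: Z_def Y'_def)
      thus False using c xy(3) True by simp
    next
      case False
      hence "x \<in> X" "f x \<in> Y" using xy(2) by (auto simp: Z_def Y'_def)
      thus False using c xy(1) False by simp
    qed
  qed
  hence "x \<in> X" "y \<in> X" using xy by auto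
  hence "f x \<in> Y" "f y \<notin> Y" using xy by (auto simp: Z_def Y'_def split: if_splits)
  thus "\<exists>e\<in>{e \<in> T. ends e \<subseteq> X}. f ` ends e \<inter> Y \<noteq> {} \<and> f ` ends e - Y \<noteq> {}"
    using e(1) sub xy by (intro bexI[of _ e]) blast+
qed

lemma multigraph_image:
  assumes "multigraph V ends E" "X \<subseteq> V"
  shows "multigraph (f ` X) (\<lambda>e. f ` ends e) {e \<in> E. ends e \<subseteq> X}"
proof -
  have "finite X" using assms by (auto simp: multigraph_def intro: finite_subset)
  moreover have "card (f ` ends e) \<le> 2" if "e \<in> E" for e
  proof -
    have "finite (ends e)" "card (ends e) \<le> 2"
      using assms that by (auto simp: multigraph_def intro: finite_subset)
    thus ?thesis using card_image_le[of "ends e" f] by linarith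
  qed
  ultimately show ?thesis using assms by (auto simp: multigraph_def)
qed

lemma multigraph_restrict:
  assumes "multigraph V ends E" "X \<subseteq> V"
  shows "multigraph X ends {e \<in> E. ends e \<subseteq> X}"
  using multigraph_image[OF assms, of "\<lambda>x. x"] by simp

text \<open>
  The trees of the graph with \<open>a\<close> and \<open>b\<close> identified; the condition on the size of \<open>T\<close>
  excludes everything in the case \<open>a = b\<close>.
\<close>

definition num_merged :: "'v \<Rightarrow> 'v \<Rightarrow> 'v set \<Rightarrow> ('e \<Rightarrow> 'v set) \<Rightarrow> 'e set \<Rightarrow> nat" where
  "num_merged a b V ends E =
     card {T. T \<subseteq> E \<and> tree_set (merge a b ` V) (contract a b ends) T \<and> card T + 2 = card V}"

lemma num_merged_bound:
  assumes "multigraph V ends E" "a \<in> V" "b \<in> V" "card E + 1 = card V + k"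
  shows "real (num_merged a b V ends E) \<le> tree_bound (Suc k) (card E)"
proof (cases "a = b")
  case True
  hence "merge a b = (\<lambda>x. x)" by (auto simp: merge_def)
  hence "{T. T \<subseteq> E \<and> tree_set (merge a b ` V) (contract a b ends) T \<and> card T + 2 = card V} = {}"
    by (auto simp: tree_set_def)
  thus ?thesis unfolding num_merged_def by (simp only: card.empty of_nat_0 tree_bound_nonneg)
next
  case False
  have fin: "finite V" "finite E" using assms(1) by (auto simp: multigraph_def)
  have V: "merge a b ` V = V - {b}" using False assms(2) by (force simp: merge_def)
  have "num_merged a b V ends E \<le> num_trees (V - {b}) (contract a b ends) E"
    unfolding num_merged_def num_trees_def V using fin by (intro card_mono) auto
  moreover have "card E + 1 = card (V - {b}) + Suc k"
    using assms(3,4) card_Suc_Diff1[OF fin(1) assms(3)] by simp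
  ultimately show ?thesis
    using num_trees_bound[OF multigraph_contract[OF assms(1,2) False]] by fastforce
qed

locale vertex_cut =
  fixes V :: "'v set" and ends :: "'e \<Rightarrow> 'v set" and E :: "'e set" and X :: "'v set"
  assumes mg: "multigraph V ends E" and X: "X \<subseteq> V" "X \<noteq> {}" "X \<noteq> V"
begin

abbreviation "inner Y \<equiv> {e \<in> E. ends e \<subseteq> Y}"

definition cut :: "'e set" where
  "cut = {e \<in> E. \<not> ends e \<subseteq> X \<and> \<not> ends e \<subseteq> V - X}"

lemma fin: "finite V" "finite E"
  using mg by (auto simp: multigraph_def)

lemma E_eq: "E = inner X \<union> inner (V - X) \<union> cut"
  by (auto simp: cut_def)

lemma disj: "inner X \<inter> inner (V - X) = {}" "inner X \<inter> cut = {}" "inner (V - X) \<inter> cut = {}"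
  using mg by (fastforce simp: cut_def multigraph_def)+

lemma cut_ends:
  assumes "e \<in> cut"
  obtains a b where "a \<in> X" "b \<in> V - X" "ends e = {a, b}"
proof -
  have e: "e \<in> E" "ends e \<subseteq> V" "\<not> ends e \<subseteq> X" "\<not> ends e \<subseteq> V - X"
    using assms mg by (auto simp: cut_def multigraph_def)
  then obtain a b where ab: "a \<in> ends e" "a \<in> X" "b \<in> ends e" "b \<in> V - X" by blast
  hence "ends e \<noteq> {a}" by auto
  then obtain u where "ends e = {u, a}" using nonloop_ends[OF mg e(1) ab(1)] by metis
  hence "ends e = {a, b}" using ab by auto
  thus thesis using that ab by blast
qed

lemma card_V: "card V = card X + card (V - X)"
proof -
  have "finite X" "finite (V - X)" using fin X(1) by (auto intro: finite_subset)
  hence "card (X \<union> (V - X)) = card X + card (V - X)" by (rule card_Un_disjoint) blast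
  moreover have "X \<union> (V - X) = V" using X(1) by blast
  ultimately show ?thesis by simp
qed

lemma card_tree_split:
  assumes "T \<subseteq> E"
  shows "card T = card {e \<in> T. ends e \<subseteq> X} + card {e \<in> T. ends e \<subseteq> V - X} + card (T \<inter> cut)"
proof -
  have fT: "finite T" using assms fin finite_subset by blast
  let ?A = "{e \<in> T. ends e \<subseteq> X}" and ?B = "{e \<in> T. ends e \<subseteq> V - X}"
  have "T = ?A \<union> ?B \<union> (T \<inter> cut)"
    using assms E_eq by blast
  hence "card T = card (?A \<union> ?B \<union> (T \<inter> cut))" by (rule arg_cong)
  also have "\<dots> = card (?A \<union> ?B) + card (T \<inter> cut)"
    using fT assms disj by (intro card_Un_disjoint) (simp, simp, blast)
  also have "card (?A \<union> ?B) = card ?A + card ?B"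
    using fT assms disj by (intro card_Un_disjoint) (simp, simp, blast)
  finally show ?thesis .
qed

lemma tree_meets_cut:
  assumes "T \<subseteq> E" "linked V ends T"
  shows "T \<inter> cut \<noteq> {}"
proof -
  obtain e where "e \<in> T" "ends e \<inter> X \<noteq> {}" "ends e - X \<noteq> {}"
    using assms(2) X unfolding linked_def by blast
  hence "e \<in> T \<inter> cut" using assms(1) by (auto simp: cut_def)
  thus ?thesis by blast
qed

text \<open>Used with the identity for \<open>f\<close> if \<open>T\<close> has one cut edge, and
  with the identification of the two feet in \<open>X\<close> if it has two.\<close>

lemma linked_side:
  assumes T: "T \<subseteq> E" "linked V ends T" and c: "\<And>e. e \<in> T \<inter> cut \<Longrightarrow> f ` (ends e \<inter> X) \<subseteq> {c}"
  shows "linked (f ` X) (\<lambda>e. f ` ends e) {e \<in> T. ends e \<subseteq> X}"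
proof (rule linked_restrict[OF T(2) X(1,2), where c = c])
  show eV: "\<And>e. e \<in> T \<Longrightarrow> ends e \<subseteq> V" using T(1) mg by (auto simp: multigraph_def)
  fix e assume e: "e \<in> T" "\<not> ends e \<subseteq> X"
  show "f ` (ends e \<inter> X) \<subseteq> {c}"
  proof (cases "e \<in> cut")
    case False
    hence "ends e \<inter> X = {}" using e T(1) by (auto simp: cut_def)
    thus ?thesis by simp
  qed (use c e in blast)
qed

lemma complement: "vertex_cut V ends E (V - X)"
  using mg X by unfold_locales auto

lemma cut_complement: "vertex_cut.cut V ends E (V - X) = cut"
  using X(1) vertex_cut.cut_def[OF complement] by (auto simp: cut_def double_diff)

text \<open>Restricting a tree to the two sides is injective since its part in the cut is fixed.
  Both restrictions are linked, and the edge count then forces each to have exactly one edge fewer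
  than its side has vertices.\<close>

lemma card_trees_one:
  assumes "e \<in> cut"
  shows "card {T. T \<subseteq> E \<and> tree_set V ends T \<and> T \<inter> cut = {e}} \<le>
    num_trees X ends (inner X) * num_trees (V - X) ends (inner (V - X))"
proof -
  interpret co: vertex_cut V ends E "V - X" by (rule complement)
  let ?S = "{T. T \<subseteq> E \<and> tree_set V ends T \<and> T \<inter> cut = {e}}"
  let ?A = "{T. T \<subseteq> inner X \<and> tree_set X ends T}"
  let ?B = "{T. T \<subseteq> inner (V - X) \<and> tree_set (V - X) ends T}"
  let ?g = "\<lambda>T. ({f \<in> T. ends f \<subseteq> X}, {f \<in> T. ends f \<subseteq> V - X})"
  obtain a b where ab: "a \<in> X" "b \<in> V - X" "ends e = {a, b}" using cut_ends[OF assms] .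
  have img: "?g ` ?S \<subseteq> ?A \<times> ?B"
  proof (rule image_subsetI)
    fix T assume "T \<in> ?S"
    hence T: "T \<subseteq> E" "tree_set V ends T" "T \<inter> cut = {e}" by auto
    let ?TA = "{f \<in> T. ends f \<subseteq> X}" and ?TB = "{f \<in> T. ends f \<subseteq> V - X}"
    have lV: "linked V ends T" using T(2) by (simp add: tree_set_def)
    have lA: "linked X ends ?TA"
      using linked_side[OF T(1) lV, of "\<lambda>x. x" a] T(3) ab by auto
    have lB: "linked (V - X) ends ?TB"
      using co.linked_side[OF T(1) lV, of "\<lambda>x. x" b] T(3) ab unfolding cut_complement by auto
    have mA: "multigraph X ends ?TA" and mB: "multigraph (V - X) ends ?TB"
      using multigraph_restrict[OF multigraph_subset[OF mg T(1)]] X(1) by auto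
    have "card ?TA + card ?TB + 1 + 1 = card X + card (V - X)"
      using card_tree_split[OF T(1)] T(2,3) card_V by (simp add: tree_set_def)
    hence "card ?TA + 1 = card X" "card ?TB + 1 = card (V - X)"
      using linked_card[OF mA lA] linked_card[OF mB lB] by linarith+
    thus "?g T \<in> ?A \<times> ?B"
      using lA lB mA mB T(1) by (auto simp: tree_set_def multigraph_def)
  qed
  have inj: "inj_on ?g ?S"
  proof (rule inj_onI)
    fix T T' assume T: "T \<in> ?S" "T' \<in> ?S" "?g T = ?g T'"
    have "S = {f \<in> S. ends f \<subseteq> X} \<union> {f \<in> S. ends f \<subseteq> V - X} \<union> {e}" if "S \<in> ?S" for S
      using that E_eq by blast
    from this[OF T(1)] this[OF T(2)] show "T = T'" using T(3) by (simp only: prod.inject)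
  qed
  have "finite (?A \<times> ?B)" using fin by auto
  hence "card ?S \<le> card (?A \<times> ?B)" by (rule card_inj_on_le[OF inj img])
  thus ?thesis by (simp add: num_trees_def card_cartesian_product)
qed

lemma num_trees_cut_empty:
  assumes "cut = {}"
  shows "num_trees V ends E = 0"
proof -
  have "{T. T \<subseteq> E \<and> tree_set V ends T} = {}"
    using tree_meets_cut assms by (auto simp: tree_set_def)
  thus ?thesis unfolding num_trees_def by (simp only: card.empty)
qed

lemma num_trees_cut_one:
  assumes "cut = {e}"
  shows "num_trees V ends E \<le> num_trees X ends (inner X) * num_trees (V - X) ends (inner (V - X))"
proof -
  have "{T. T \<subseteq> E \<and> tree_set V ends T} = {T. T \<subseteq> E \<and> tree_set V ends T \<and> T \<inter> cut = {e}}"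
    using tree_meets_cut assms by (auto simp: tree_set_def)
  thus ?thesis using card_trees_one[of e] assms by (simp add: num_trees_def)
qed

text \<open>If \<open>Y\<close> split the part in \<open>X\<close> and \<open>Z\<close> the part in
  \<open>V - X\<close>, the edges \<open>e1\<close> and \<open>e2\<close> alone would have to link
  the four pieces, which takes three edges. The contradiction comes from applying \<open>key\<close>
  to the four pieces and to the unions of \<open>Y\<close> with each piece of
  \<open>V - X\<close>.\<close>

lemma linked_one_side:
  assumes T: "T \<subseteq> E" "linked V ends T" "T \<inter> cut = {e1, e2}"
    and ends: "a1 \<in> X" "b1 \<in> V - X" "ends e1 = {a1, b1}" "a2 \<in> X" "b2 \<in> V - X" "ends e2 = {a2, b2}"
  shows "linked X ends {e \<in> T. ends e \<subseteq> X} \<or> linked (V - X) ends {e \<in> T. ends e \<subseteq> V - X}"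
proof (rule ccontr)
  assume "\<not> ?thesis"
  hence nl: "\<not> linked X ends {e \<in> T. ends e \<subseteq> X}" "\<not> linked (V - X) ends {e \<in> T. ends e \<subseteq> V - X}"
    by auto
  obtain Y where Y: "Y \<subseteq> X" "Y \<noteq> {}" "Y \<noteq> X"
      "\<forall>e\<in>{e \<in> T. ends e \<subseteq> X}. ends e \<inter> Y = {} \<or> ends e \<subseteq> Y"
    by (rule not_linkedE[OF nl(1) X(2)])
  have "V - X \<noteq> {}" using X by auto
  obtain Z where Z: "Z \<subseteq> V - X" "Z \<noteq> {}" "Z \<noteq> V - X"
      "\<forall>e\<in>{e \<in> T. ends e \<subseteq> V - X}. ends e \<inter> Z = {} \<or> ends e \<subseteq> Z"
    by (rule not_linkedE[OF nl(2) \<open>V - X \<noteq> {}\<close>])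
  have key: "(a1 \<in> W) \<noteq> (b1 \<in> W) \<or> (a2 \<in> W) \<noteq> (b2 \<in> W)"
    if W: "W \<subseteq> V" "W \<noteq> {}" "W \<noteq> V"
      and WX: "W \<inter> X \<in> {{}, Y, X - Y}" and WZ: "W - X \<in> {{}, Z, V - X - Z}" for W
  proof -
    obtain e where e: "e \<in> T" "ends e \<inter> W \<noteq> {}" "ends e - W \<noteq> {}"
      using T(2) W unfolding linked_def by blast
    then obtain x y where xy: "x \<in> ends e" "x \<in> W" "y \<in> ends e" "y \<notin> W" by blast
    have "\<not> ends e \<subseteq> X"
    proof
      assume s: "ends e \<subseteq> X"
      have "ends e \<inter> P = {} \<or> ends e \<subseteq> P" if "P \<in> {{}, Y, X - Y}" for P
        using that bspec[OF Y(4), of e] e(1) s by auto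
      from this[OF WX] show False using xy subsetD[OF s xy(1)] by blast
    qed
    moreover have "\<not> ends e \<subseteq> V - X"
    proof
      assume s: "ends e \<subseteq> V - X"
      have "ends e \<inter> P = {} \<or> ends e \<subseteq> P" if "P \<in> {{}, Z, V - X - Z}" for P
        using that bspec[OF Z(4), of e] e(1) s by auto
      from this[OF WZ] show False using xy subsetD[OF s xy(1)] by blast
    qed
    ultimately have "e \<in> T \<inter> cut" using e(1) T(1) by (auto simp: cut_def)
    hence "e = e1 \<or> e = e2" using T(3) by blast
    thus ?thesis using xy ends(3,6) by auto
  qed
  have nab: "b1 \<notin> Y" "b2 \<notin> Y" "a1 \<notin> Z" "a2 \<notin> Z" using Y(1) Z(1) ends(1,2,4,5) by blast+
  have YZ: "Y \<inter> X = Y" "Y - X = {}" "X - Y \<noteq> {}" "(X - Y) \<inter> X = X - Y" "X - Y - X = {}"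
      "Z \<inter> X = {}" "Z - X = Z" "V - X - Z \<noteq> {}" "(V - X - Z) \<inter> X = {}" "V - X - Z - X = V - X - Z"
    using Y(1-3) Z(1-3) X(1) by blast+
  have sub: "Y \<subseteq> V" "Y \<noteq> V" "X - Y \<subseteq> V" "X - Y \<noteq> V" "Z \<subseteq> V" "Z \<noteq> V" "V - X - Z \<subseteq> V" "V - X - Z \<noteq> V"
      "Y \<union> Z \<subseteq> V" "Y \<union> Z \<noteq> V" "Y \<union> Z \<noteq> {}" "Y \<union> (V - X - Z) \<subseteq> V" "Y \<union> (V - X - Z) \<noteq> V"
      "Y \<union> (V - X - Z) \<noteq> {}"
    using Y(1-3) Z(1-3) X by blast+
  have YZ': "(Y \<union> Z) \<inter> X = Y" "Y \<union> Z - X = Z"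
      "(Y \<union> (V - X - Z)) \<inter> X = Y" "Y \<union> (V - X - Z) - X = V - X - Z"
    using Y(1) Z(1) by blast+
  have "(a1 \<in> Y) \<noteq> (b1 \<in> Y) \<or> (a2 \<in> Y) \<noteq> (b2 \<in> Y)"
    by (rule key[OF sub(1) Y(2) sub(2)]) (simp_all add: YZ)
  hence "a1 \<in> Y \<or> a2 \<in> Y" using nab by simp
  moreover have "(a1 \<in> X - Y) \<noteq> (b1 \<in> X - Y) \<or> (a2 \<in> X - Y) \<noteq> (b2 \<in> X - Y)"
    by (rule key[OF sub(3) YZ(3) sub(4)]) (simp_all only: YZ insert_iff simp_thms)
  hence "a1 \<notin> Y \<or> a2 \<notin> Y" using ends(1,2,4,5) by blast
  moreover have "(a1 \<in> Z) \<noteq> (b1 \<in> Z) \<or> (a2 \<in> Z) \<noteq> (b2 \<in> Z)"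
    by (rule key[OF sub(5) Z(2) sub(6)]) (simp_all add: YZ)
  hence "b1 \<in> Z \<or> b2 \<in> Z" using nab by simp
  moreover have "(a1 \<in> V - X - Z) \<noteq> (b1 \<in> V - X - Z) \<or> (a2 \<in> V - X - Z) \<noteq> (b2 \<in> V - X - Z)"
    by (rule key[OF sub(7) YZ(8) sub(8)]) (simp_all only: YZ insert_iff simp_thms)
  hence "b1 \<notin> Z \<or> b2 \<notin> Z" using ends(1,2,4,5) by blast
  \<comment> \<open>By now exactly one of \<open>a1\<close>, \<open>a2\<close> lies in
    \<open>Y\<close> and exactly one of \<open>b1\<close>, \<open>b2\<close> in \<open>Z\<close>. So
    the two cut edges pair the pieces up, and one of the two unions tested here is left by neither
    edge.\<close>
  moreover have "(a1 \<in> Y \<union> Z) \<noteq> (b1 \<in> Y \<union> Z) \<or> (a2 \<in> Y \<union> Z) \<noteq> (b2 \<in> Y \<union> Z)"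
    by (rule key[OF sub(9) sub(11) sub(10)]) (simp_all only: YZ' insert_iff simp_thms)
  hence "(a1 \<in> Y) \<noteq> (b1 \<in> Z) \<or> (a2 \<in> Y) \<noteq> (b2 \<in> Z)" using nab by simp
  moreover have "(a1 \<in> Y \<union> (V - X - Z)) \<noteq> (b1 \<in> Y \<union> (V - X - Z)) \<or>
      (a2 \<in> Y \<union> (V - X - Z)) \<noteq> (b2 \<in> Y \<union> (V - X - Z))"
    by (rule key[OF sub(12) sub(14) sub(13)]) (simp_all only: YZ' insert_iff simp_thms)
  hence "(a1 \<in> Y) = (b1 \<in> Z) \<or> (a2 \<in> Y) = (b2 \<in> Z)" using nab ends(1,2,4,5) by simp
  ultimately show False by satx
qed

text \<open>One side of the tree stays connected and is a spanning tree there. It joins the feet of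
  the cut edges on the other side, whose part therefore becomes a tree once these feet are
  identified.\<close>

lemma card_trees_two:
  assumes cut: "cut = {e1, e2}" "e1 \<noteq> e2"
    and ends: "a1 \<in> X" "b1 \<in> V - X" "ends e1 = {a1, b1}" "a2 \<in> X" "b2 \<in> V - X" "ends e2 = {a2, b2}"
  shows "card {T. T \<subseteq> E \<and> tree_set V ends T \<and> T \<inter> cut = {e1, e2}} \<le>
    num_trees X ends (inner X) * num_merged b1 b2 (V - X) ends (inner (V - X)) +
    num_merged a1 a2 X ends (inner X) * num_trees (V - X) ends (inner (V - X))"
proof -
  interpret co: vertex_cut V ends E "V - X" by (rule complement)
  let ?S = "{T. T \<subseteq> E \<and> tree_set V ends T \<and> T \<inter> cut = {e1, e2}}"
  let ?A = "{T. T \<subseteq> inner X \<and> tree_set X ends T}"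
  let ?B = "{T. T \<subseteq> inner (V - X) \<and> tree_set (V - X) ends T}"
  let ?A' = "{T. T \<subseteq> inner X \<and> tree_set (merge a1 a2 ` X) (contract a1 a2 ends) T \<and> card T + 2 = card X}"
  let ?B' = "{T. T \<subseteq> inner (V - X) \<and> tree_set (merge b1 b2 ` (V - X)) (contract b1 b2 ends) T \<and>
    card T + 2 = card (V - X)}"
  let ?g = "\<lambda>T. ({f \<in> T. ends f \<subseteq> X}, {f \<in> T. ends f \<subseteq> V - X})"
  have img: "?g ` ?S \<subseteq> ?A \<times> ?B' \<union> ?A' \<times> ?B"
  proof (rule image_subsetI)
    fix T assume "T \<in> ?S"
    hence T: "T \<subseteq> E" "tree_set V ends T" "T \<inter> cut = {e1, e2}" by auto
    let ?TA = "{f \<in> T. ends f \<subseteq> X}" and ?TB = "{f \<in> T. ends f \<subseteq> V - X}"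
    have lV: "linked V ends T" using T(2) by (simp add: tree_set_def)
    have mgT: "multigraph V ends T" by (rule multigraph_subset[OF mg T(1)])
    have fTA: "finite ?TA" "finite ?TB" using mgT by (auto simp: multigraph_def)
    have sub: "?TA \<subseteq> inner X" "?TB \<subseteq> inner (V - X)" using T(1) by auto
    have ends_X: "ends e1 \<inter> X = {a1}" "ends e2 \<inter> X = {a2}"
      "ends e1 \<inter> (V - X) = {b1}" "ends e2 \<inter> (V - X) = {b2}" using ends by auto
    have lA: "linked (merge a1 a2 ` X) (contract a1 a2 ends) ?TA"
      using T(3) ends_X by (intro linked_side[OF T(1) lV, where c = a1]) (auto simp: merge_def)
    have lB: "linked (merge b1 b2 ` (V - X)) (contract b1 b2 ends) ?TB"
      using T(3) ends_X
      by (intro co.linked_side[OF T(1) lV, where c = b1]) (auto simp: merge_def cut_complement)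
    have cA: "card (merge a1 a2 ` X) \<le> card ?TA + 1" and cB: "card (merge b1 b2 ` (V - X)) \<le> card ?TB + 1"
      by (rule linked_card[OF multigraph_image[OF mgT] lA], fact X)
        (rule linked_card[OF multigraph_image[OF mgT] lB], blast)
    \<comment> \<open>Identification loses at most one vertex. Hence the side that may be
      disconnected still has at least two edges fewer than vertices at worst, and the total in
      \<open>tot\<close> makes all estimates equalities.\<close>
    have le: "card Y \<le> card (merge a b ` Y) + 1" if "finite Y" for a b and Y :: "'v set"
    proof -
      have "Y - {b} \<subseteq> merge a b ` Y" by (force simp: merge_def)
      hence "card (Y - {b}) \<le> card (merge a b ` Y)" using that by (intro card_mono) auto
      moreover have "card Y \<le> card (Y - {b}) + 1" using that by (cases "b \<in> Y") (auto simp: card_Diff_singleton)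
      ultimately show ?thesis by linarith
    qed
    have fX: "finite X" "finite (V - X)" using fin X(1) by (auto intro: finite_subset)
    have tot: "card ?TA + card ?TB + 3 = card X + card (V - X)"
      using card_tree_split[OF T(1)] T(2,3) card_V cut(2) by (simp add: tree_set_def)
    have "linked X ends ?TA \<or> linked (V - X) ends ?TB"
      by (rule linked_one_side[OF T(1) lV T(3) ends])
    thus "?g T \<in> ?A \<times> ?B' \<union> ?A' \<times> ?B"
    proof
      assume l: "linked X ends ?TA"
      have "card X \<le> card ?TA + 1"
        using linked_card[OF multigraph_restrict[OF mgT X(1)] l] .
      hence c: "card ?TA + 1 = card X" "card ?TB + 2 = card (V - X)"
          "card ?TB + 1 = card (merge b1 b2 ` (V - X))"
        using tot cB le[OF fX(2), of b1 b2] by linarith+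
      hence "tree_set X ends ?TA" "tree_set (merge b1 b2 ` (V - X)) (contract b1 b2 ends) ?TB"
        using l lB fTA by (simp_all add: tree_set_def)
      thus ?thesis using sub c(2) by blast
    next
      assume l: "linked (V - X) ends ?TB"
      have "card (V - X) \<le> card ?TB + 1"
        using linked_card[OF multigraph_restrict[OF mgT] l] by blast
      hence c: "card ?TB + 1 = card (V - X)" "card ?TA + 2 = card X"
          "card ?TA + 1 = card (merge a1 a2 ` X)"
        using tot cA le[OF fX(1), of a1 a2] by linarith+
      hence "tree_set (V - X) ends ?TB" "tree_set (merge a1 a2 ` X) (contract a1 a2 ends) ?TA"
        using l lA fTA by (simp_all add: tree_set_def)
      thus ?thesis using sub c(2) by blast
    qed
  qed
  have inj: "inj_on ?g ?S"
  proof (rule inj_onI)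
    fix T T' assume T: "T \<in> ?S" "T' \<in> ?S" "?g T = ?g T'"
    have "S = {f \<in> S. ends f \<subseteq> X} \<union> {f \<in> S. ends f \<subseteq> V - X} \<union> {e1, e2}" if "S \<in> ?S" for S
      using that E_eq by blast
    from this[OF T(1)] this[OF T(2)] show "T = T'" using T(3) by (simp only: prod.inject)
  qed
  have "finite (?A \<times> ?B' \<union> ?A' \<times> ?B)" using fin by auto
  hence "card ?S \<le> card (?A \<times> ?B' \<union> ?A' \<times> ?B)" by (rule card_inj_on_le[OF inj img])
  also have "\<dots> \<le> card (?A \<times> ?B') + card (?A' \<times> ?B)" by (rule card_Un_le)
  finally show ?thesis by (simp add: num_trees_def num_merged_def card_cartesian_product)
qed

lemma num_trees_cut_two:
  assumes cut: "cut = {e1, e2}" "e1 \<noteq> e2"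
    and ends: "a1 \<in> X" "b1 \<in> V - X" "ends e1 = {a1, b1}" "a2 \<in> X" "b2 \<in> V - X" "ends e2 = {a2, b2}"
  shows "num_trees V ends E \<le>
    2 * num_trees X ends (inner X) * num_trees (V - X) ends (inner (V - X)) +
    num_trees X ends (inner X) * num_merged b1 b2 (V - X) ends (inner (V - X)) +
    num_merged a1 a2 X ends (inner X) * num_trees (V - X) ends (inner (V - X))"
proof -
  let ?S = "\<lambda>D. {T. T \<subseteq> E \<and> tree_set V ends T \<and> T \<inter> cut = D}"
  have "{T. T \<subseteq> E \<and> tree_set V ends T} \<subseteq> ?S {e1} \<union> ?S {e2} \<union> ?S {e1, e2}"
  proof
    fix T assume "T \<in> {T. T \<subseteq> E \<and> tree_set V ends T}"
    hence T: "T \<subseteq> E" "tree_set V ends T" by auto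
    have "T \<inter> cut \<noteq> {}" using T tree_meets_cut by (simp add: tree_set_def)
    moreover have "T \<inter> cut \<subseteq> {e1, e2}" using cut(1) by blast
    ultimately have "T \<inter> cut = {e1} \<or> T \<inter> cut = {e2} \<or> T \<inter> cut = {e1, e2}" by blast
    thus "T \<in> ?S {e1} \<union> ?S {e2} \<union> ?S {e1, e2}" using T by blast
  qed
  moreover have "finite (?S {e1} \<union> ?S {e2} \<union> ?S {e1, e2})" using fin by auto
  ultimately have "num_trees V ends E \<le> card (?S {e1} \<union> ?S {e2} \<union> ?S {e1, e2})"
    unfolding num_trees_def by (intro card_mono)
  also have "\<dots> \<le> card (?S {e1}) + card (?S {e2}) + card (?S {e1, e2})"
    by (rule order.trans[OF card_Un_le]) (simp add: card_Un_le)
  finally show ?thesis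
    using card_trees_one[of e1] card_trees_one[of e2] card_trees_two[OF cut ends] cut by simp
qed

end

section \<open>Cubic graphs of large complexity\<close>

lemma card_incident:
  assumes "cubic_graph G" "v \<in> pverts G"
  shows "card {e \<in> edges G. v \<in> e} = 3"
proof -
  have pg: "pair_graph G" using assms by (simp add: cubic_graph_def)
  let ?O = "{a \<in> parcs G. fst a = v}" and ?I = "{e \<in> edges G. v \<in> e}"
  have "bij_betw (\<lambda>a. {fst a, snd a}) ?O ?I"
  proof (rule bij_betw_imageI)
    show "inj_on (\<lambda>a. {fst a, snd a}) ?O"
      by (rule inj_onI) (auto simp: doubleton_eq_iff)
    show "(\<lambda>a. {fst a, snd a}) ` ?O = ?I"
    proof (intro equalityI subsetI)
      fix e assume "e \<in> (\<lambda>a. {fst a, snd a}) ` ?O"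
      thus "e \<in> ?I" using mem_edges[OF pg] by auto
    next
      fix e assume e: "e \<in> ?I"
      then obtain u w where uw: "e = {u, w}" "(u, w) \<in> parcs G" by (auto elim: edgeE)
      hence "(w, u) \<in> parcs G" using mem_edges[OF pg, of w u] mem_edges[OF pg, of u w] by (simp add: insert_commute)
      hence "\<exists>x. (v, x) \<in> ?O \<and> e = {v, x}" using uw e by auto
      thus "e \<in> (\<lambda>a. {fst a, snd a}) ` ?O" by force
    qed
  qed
  hence "card ?O = card ?I" by (rule bij_betw_same_card)
  moreover have "card ?O = 3" using assms by (auto simp: cubic_graph_def out_degree_def out_arcs_def)
  ultimately show ?thesis by simp
qed

lemma complexity_eq_num_trees:
  "pair_graph G \<Longrightarrow> complexity G = num_trees (pverts G) (\<lambda>e. e) (edges G)"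
  by (simp add: complexity_eq_card num_trees_def)

lemma complexity_cubic_det:
  assumes "cubic_graph G" "pverts G = insert r (set us)" "distinct (r # us)"
  shows "real (complexity G) = det (mat (length us) (length us)
    (\<lambda>(i, j). if i = j then 3 else if (us ! i, us ! j) \<in> parcs G then - 1 else 0))"
proof -
  have pg: "pair_graph G" using assms by (simp add: cubic_graph_def)
  have "laplacian (\<lambda>e. e) (edges G) us = mat (length us) (length us)
    (\<lambda>(i, j). if i = j then 3 else if (us ! i, us ! j) \<in> parcs G then - 1 else 0)"
    unfolding laplacian_def
  proof (rule cong_mat, simp_all only: prod.case)
    fix i j assume ij: "i < length us" "j < length us"
    have "e \<noteq> {us ! i}" if "e \<in> edges G" for e
    proof -
      interpret pair_graph G by (rule pg)
      show ?thesis using that no_loops' by (auto elim!: edgeE)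
    qed
    hence "{e \<in> edges G. us ! i \<in> e \<and> e \<noteq> {us ! i}} = {e \<in> edges G. us ! i \<in> e}" by blast
    moreover have "us ! i \<in> pverts G" using assms(2) ij by simp
    moreover have "{e \<in> edges G. e = {us ! i, us ! j}} =
        (if (us ! i, us ! j) \<in> parcs G then {{us ! i, us ! j}} else {})"
      using mem_edges[OF pg, of "us ! i" "us ! j"] by auto
    ultimately show "(if i = j then real (card {e \<in> edges G. us ! i \<in> e \<and> e \<noteq> {us ! i}})
        else - real (card {e \<in> edges G. e = {us ! i, us ! j}})) =
        (if i = j then 3 else if (us ! i, us ! j) \<in> parcs G then - 1 else 0)"
      using card_incident[OF assms(1), of "us ! i"] by (cases "i = j") simp_all
  qed
  thus ?thesis
    using matrix_tree[of r us "\<lambda>e. e" "edges G"] multigraph_edges[OF pg] assms(2,3)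
      complexity_eq_num_trees[OF pg] num_trees_eq_kirch[of "pverts G" "\<lambda>e. e" "edges G"] by simp
qed

text \<open>
  Row \<open>i\<close> of \<open>p\<close> is a combination of the first rows of \<open>l\<close> that is orthogonal to the columns
  before \<open>i\<close>, so that the product of the two matrices is upper triangular.
\<close>

lemma det_triangular_certificate:
  fixes p l :: "nat \<Rightarrow> nat \<Rightarrow> real"
  assumes "\<And>i j. i < n \<Longrightarrow> j < i \<Longrightarrow> (\<Sum>k\<le>i. p i k * l k j) = 0"
  shows "(\<Prod>i<n. p i i) * det (mat n n (\<lambda>(i, j). l i j)) = (\<Prod>i<n. \<Sum>k\<le>i. p i k * l k i)"
proof -
  define P where "P = mat n n (\<lambda>(i, j). if j \<le> i then p i j else 0)"
  define L where "L = mat n n (\<lambda>(i, j). l i j)"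
  have car: "P \<in> carrier_mat n n" "L \<in> carrier_mat n n" "P * L \<in> carrier_mat n n"
    by (auto simp: P_def L_def)
  have PL: "(P * L) $$ (i, j) = (\<Sum>k\<le>i. p i k * l k j)" if "i < n" "j < n" for i j
  proof -
    have "(P * L) $$ (i, j) = (\<Sum>k<n. (if k \<le> i then p i k else 0) * l k j)"
      using that by (auto simp: P_def L_def scalar_prod_def lessThan_atLeast0 intro!: sum.cong)
    also have "\<dots> = (\<Sum>k\<le>i. p i k * l k j)"
      using that by (intro sum.mono_neutral_cong_right) auto
    finally show ?thesis .
  qed
  have "det P = (\<Prod>i<n. p i i)"
    using det_lower_triangular[OF _ car(1)]
    by (simp add: P_def prod_list_diag_prod lessThan_atLeast0)
  moreover have "det (P * L) = (\<Prod>i<n. \<Sum>k\<le>i. p i k * l k i)"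
  proof -
    have "upper_triangular (P * L)"
      using PL assms car by (intro upper_triangularI) auto
    hence "det (P * L) = prod_list (diag_mat (P * L))" using car(3) by (rule det_upper_triangular)
    also have "\<dots> = (\<Prod>i<n. (P * L) $$ (i, i))"
      using car(1) by (simp add: prod_list_diag_prod lessThan_atLeast0)
    finally show ?thesis using PL by simp
  qed
  ultimately show ?thesis using det_mult[OF car(1,2)] by (simp add: L_def)
qed

text \<open>
  The cubic graphs with LCF code \<open>[5, - 5]\<close>: a Hamiltonian cycle with chords from each even \<open>i\<close> to
  \<open>i + 5\<close>. For 8, 10 and 14 vertices these are the cube, the Moebius ladder and the Heawood graph.
\<close>

definition lcf_nbrs :: "nat \<Rightarrow> nat \<Rightarrow> nat list" where
  "lcf_nbrs n i =
     [(i + 1) mod n, (i + n - 1) mod n, (if even i then i + 5 else i + n - 5) mod n]"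

text \<open>The map \<open>f\<close> carries the numbered vertices into the vertex type of the given
  graph, which its competitors must share.\<close>

definition lcf_graph :: "(nat \<Rightarrow> 'a) \<Rightarrow> nat \<Rightarrow> 'a pair_pre_digraph" where
  "lcf_graph f n =
     \<lparr>pverts = f ` {..<n}, parcs = {(f i, f j) |i j. i < n \<and> j \<in> set (lcf_nbrs n i)}\<rparr>"

definition lcf_ok :: "nat \<Rightarrow> bool" where
  "lcf_ok n \<longleftrightarrow> list_all (\<lambda>i. distinct (i # lcf_nbrs n i) \<and>
     list_all (\<lambda>j. j < n \<and> i \<in> set (lcf_nbrs n j)) (lcf_nbrs n i)) [0..<n]"

text \<open>Vertex 0 is the omitted root, so row \<open>i\<close> belongs to vertex
  \<open>Suc i\<close>.\<close>

definition lcf_laplacian :: "nat \<Rightarrow> nat \<Rightarrow> nat \<Rightarrow> int" where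
  "lcf_laplacian n i j = (if i = j then 3 else if Suc j \<in> set (lcf_nbrs n (Suc i)) then - 1 else 0)"

definition lcf_dot :: "nat \<Rightarrow> int list list \<Rightarrow> nat \<Rightarrow> nat \<Rightarrow> int" where
  "lcf_dot n P i j = (\<Sum>k\<leftarrow>[0..<Suc i]. P ! i ! k * lcf_laplacian n k j)"

text \<open>The condition on zeros is the hypothesis of \<open>det_triangular_certificate\<close>;
  the nonzero diagonal allows the determinant to be found by division. Everything is integral, so
  evaluation is exact.\<close>

definition lcf_certificate :: "nat \<Rightarrow> int list list \<Rightarrow> bool" where
  "lcf_certificate n P \<longleftrightarrow>
     list_all (\<lambda>i. P ! i ! i \<noteq> 0 \<and> list_all (\<lambda>j. lcf_dot n P i j = 0) [0..<i]) [0..<n - 1]"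

lemma lcf_okD:
  assumes "lcf_ok n" "i < n"
  shows "distinct (i # lcf_nbrs n i)"
    and "\<And>j. j \<in> set (lcf_nbrs n i) \<Longrightarrow> j < n \<and> i \<in> set (lcf_nbrs n j)"
proof -
  have "i \<in> set [0..<n]" using assms(2) by simp
  note * = bspec[OF assms(1)[unfolded lcf_ok_def list_all_iff] this]
  show "distinct (i # lcf_nbrs n i)" by (rule conjunct1[OF *])
  show "j < n \<and> i \<in> set (lcf_nbrs n j)" if "j \<in> set (lcf_nbrs n i)" for j
    by (rule bspec[OF conjunct2[OF *] that])
qed

lemma parcs_lcf_graph:
  assumes "lcf_ok n" "inj_on f {..<n}" "i < n" "j < n"
  shows "(f i, f j) \<in> parcs (lcf_graph f n) \<longleftrightarrow> j \<in> set (lcf_nbrs n i)"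
proof
  assume "(f i, f j) \<in> parcs (lcf_graph f n)"
  then obtain i' j' where ij: "f i = f i'" "f j = f j'" "i' < n" "j' \<in> set (lcf_nbrs n i')"
    by (auto simp: lcf_graph_def)
  moreover have "j' < n" using lcf_okD(2)[OF assms(1) ij(3,4)] by simp
  ultimately have "i = i'" "j = j'" using assms(2-4) by (simp_all add: inj_on_eq_iff)
  thus "j \<in> set (lcf_nbrs n i)" using ij(4) by simp
qed (use assms(3) in \<open>auto simp: lcf_graph_def\<close>)

lemma cubic_lcf_graph:
  assumes "lcf_ok n" "inj_on f {..<n}"
  shows "cubic_graph (lcf_graph f n)"
  unfolding cubic_graph_def
proof (intro conjI ballI)
  let ?G = "lcf_graph f n"
  have arc: "\<exists>i j. a = (f i, f j) \<and> i < n \<and> j < n \<and> i \<noteq> j \<and> j \<in> set (lcf_nbrs n i) \<and> i \<in> set (lcf_nbrs n j)"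
    if a: "a \<in> parcs ?G" for a
  proof -
    obtain i j where ij: "a = (f i, f j)" "i < n" "j \<in> set (lcf_nbrs n i)"
      using a by (auto simp: lcf_graph_def)
    moreover have "i \<noteq> j" using lcf_okD(1)[OF assms(1) ij(2)] ij(3) by auto
    ultimately show ?thesis using lcf_okD(2)[OF assms(1) ij(2,3)] by blast
  qed
  have V: "pverts ?G = f ` {..<n}" by (simp add: lcf_graph_def)
  show "pair_graph ?G"
  proof
    show "symmetric (with_proj ?G)"
      unfolding symmetric_def
    proof (rule symI)
      fix a b assume "(a, b) \<in> arcs_ends (with_proj ?G)"
      then obtain i j where "a = f i" "b = f j" "j < n" "i \<in> set (lcf_nbrs n j)"
        using arc[of "(a, b)"] by auto
      thus "(b, a) \<in> arcs_ends (with_proj ?G)" by (auto simp: lcf_graph_def)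
    qed
    have "parcs ?G \<subseteq> f ` {..<n} \<times> f ` {..<n}" using arc by blast
    thus "finite (parcs ?G)" by (rule finite_subset) simp
    show "finite (pverts ?G)" by (simp add: V)
    fix e assume e: "e \<in> parcs ?G"
    obtain i j where ij: "e = (f i, f j)" "i < n" "j < n" "i \<noteq> j" using arc[OF e] by blast
    show "fst e \<in> pverts ?G" "snd e \<in> pverts ?G" using ij V by simp_all
    show "fst e \<noteq> snd e" using ij assms(2) by (simp add: inj_on_eq_iff)
  qed
  fix v assume "v \<in> pverts ?G"
  then obtain i where i: "i < n" "v = f i" using V by auto
  have "out_arcs (with_proj ?G) v = (\<lambda>j. (v, f j)) ` set (lcf_nbrs n i)"
  proof (intro equalityI subsetI)
    fix a assume "a \<in> out_arcs (with_proj ?G) v"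
    hence a: "a \<in> parcs ?G" "fst a = v" by (auto simp: out_arcs_def)
    obtain i' j where "a = (f i', f j)" "i' < n" "j \<in> set (lcf_nbrs n i')" using arc[OF a(1)] by blast
    moreover from this have "i' = i" using a(2) i assms(2) by (simp add: inj_on_eq_iff)
    ultimately show "a \<in> (\<lambda>j. (v, f j)) ` set (lcf_nbrs n i)" using a(2) by auto
  next
    fix a assume "a \<in> (\<lambda>j. (v, f j)) ` set (lcf_nbrs n i)"
    thus "a \<in> out_arcs (with_proj ?G) v" using i by (auto simp: out_arcs_def lcf_graph_def)
  qed
  moreover have "inj_on (\<lambda>j. (v, f j)) (set (lcf_nbrs n i))"
    using lcf_okD(2)[OF assms(1) i(1)] assms(2) by (intro inj_onI) (simp add: inj_on_eq_iff)
  moreover have "card (set (lcf_nbrs n i)) = 3"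
    using distinct_card[of "lcf_nbrs n i"] lcf_okD(1)[OF assms(1) i(1)] by (simp add: lcf_nbrs_def)
  ultimately show "out_degree (with_proj ?G) v = 3" by (simp add: out_degree_def card_image)
qed

lemma complexity_lcf_graph:
  assumes "lcf_ok n" "inj_on f {..<n}" "0 < n" "lcf_certificate n P"
  shows "(\<Prod>i<n - 1. real_of_int (P ! i ! i)) * real (complexity (lcf_graph f n)) =
    (\<Prod>i<n - 1. real_of_int (lcf_dot n P i i))"
proof -
  let ?us = "map f [1..<n]"
  have n: "{..<n} = insert 0 {1..<n}" using assms(3) by auto
  have V: "pverts (lcf_graph f n) = insert (f 0) (set ?us)"
    by (simp add: lcf_graph_def n)
  have "inj_on f {1..<n}" "f 0 \<notin> f ` {1..<n}"
    using assms(2) unfolding n by auto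
  hence d: "distinct (f 0 # ?us)" by (simp add: distinct_map)
  have "mat (length ?us) (length ?us) (\<lambda>(i, j). if i = j then 3
      else if (?us ! i, ?us ! j) \<in> parcs (lcf_graph f n) then - 1 else 0) =
    mat (n - 1) (n - 1) (\<lambda>(i, j). real_of_int (lcf_laplacian n i j))"
    using parcs_lcf_graph[OF assms(1,2)] by (intro cong_mat) (auto simp: lcf_laplacian_def)
  hence det: "real (complexity (lcf_graph f n)) =
      det (mat (n - 1) (n - 1) (\<lambda>(i, j). real_of_int (lcf_laplacian n i j)))"
    using complexity_cubic_det[OF cubic_lcf_graph[OF assms(1,2)] V d] by simp
  have dot: "(\<Sum>k\<le>i. real_of_int (P ! i ! k) * real_of_int (lcf_laplacian n k j)) =
      real_of_int (lcf_dot n P i j)" for i j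
    by (simp add: lcf_dot_def interv_sum_list_conv_sum_set_nat atLeast0LessThan
        lessThan_Suc_atMost del: upt_Suc)
  have "(\<Sum>k\<le>i. real_of_int (P ! i ! k) * real_of_int (lcf_laplacian n k j)) = 0"
    if "i < n - 1" "j < i" for i j
    using assms(4) that unfolding dot by (simp add: lcf_certificate_def list_all_iff)
  from det_triangular_certificate[OF this] show ?thesis unfolding det dot .
qed

lemma prod_lessThan_of_map:
  "(\<Prod>i<n. real_of_int (g i)) = real_of_int (prod_list (map g [0..<n]))"
  by (induction n) (simp_all add: mult.commute)

section \<open>Evaluation of the four complexities\<close>

lemma lcf_ok_8: "lcf_ok 8"
  by code_simp

lemma complexity_lcf_8:
  assumes "inj_on f {..<8}"
  shows "complexity (lcf_graph f 8) = 384"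
proof -
  \<comment> \<open>Up to a positive factor that clears denominators, row \<open>i\<close> is the
    last row of the inverse of the leading block of size \<open>i + 1\<close>. While no chord joins
    the vertices seen so far, the block is tridiagonal and the row consists of the Fibonacci numbers
    1, 3, 8, and so on.\<close>
  define P :: "int list list" where "P =
     [[1],
      [1, 3],
      [1, 3, 8],
      [3, 2, 3, 7],
      [3, 2, 3, 7, 15],
      [13, 15, 32, 24, 27, 57],
      [5, 9, 8, 6, 5, 9, 14]]"
  have "lcf_certificate 8 P" unfolding P_def by code_simp
  moreover have "map (\<lambda>i. lcf_dot 8 P i i) [0..<7] = [3, 8, 21, 15, 38, 112, 24]"
    unfolding P_def by code_simp
  moreover have "map (\<lambda>i. P ! i ! i) [0..<7] = [1, 3, 8, 7, 15, 57, 14]"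
    unfolding P_def by code_simp
  ultimately show ?thesis
    using complexity_lcf_graph[of 8 f P] lcf_ok_8 assms by (simp add: prod_lessThan_of_map)
qed

lemma lcf_ok_10: "lcf_ok 10"
  by code_simp

lemma complexity_lcf_10:
  assumes "inj_on f {..<10}"
  shows "complexity (lcf_graph f 10) = 1815"
proof -
  define P :: "int list list" where "P =
     [[1],
      [1, 3],
      [1, 3, 8],
      [1, 3, 8, 21],
      [1, 3, 8, 21, 55],
      [7, 3, 2, 3, 7, 18],
      [14, 21, 9, 6, 9, 21, 40],
      [184, 315, 369, 168, 135, 237, 392, 624],
      [29, 48, 62, 66, 35, 39, 53, 72, 101]]"
  have "lcf_certificate 10 P" unfolding P_def by code_simp
  moreover have "map (\<lambda>i. lcf_dot 10 P i i) [0..<9] = [3, 8, 21, 55, 144, 40, 78, 1111, 165]"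
    unfolding P_def by code_simp
  moreover have "map (\<lambda>i. P ! i ! i) [0..<9] = [1, 3, 8, 21, 55, 18, 40, 624, 101]"
    unfolding P_def by code_simp
  ultimately show ?thesis
    using complexity_lcf_graph[of 10 f P] lcf_ok_10 assms by (simp add: prod_lessThan_of_map)
qed

lemma lcf_ok_12: "lcf_ok 12"
  by code_simp

text \<open>This is the Franklin graph.\<close>

lemma complexity_lcf_12:
  assumes "inj_on f {..<12}"
  shows "complexity (lcf_graph f 12) = 9216"
proof -
  define P :: "int list list" where "P =
     [[1],
      [1, 3],
      [1, 3, 8],
      [1, 3, 8, 21],
      [1, 3, 8, 21, 55],
      [1, 3, 8, 21, 55, 144],
      [56, 168, 71, 45, 64, 147, 377],
      [376, 312, 127, 69, 80, 171, 433, 816],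
      [456, 483, 433, 816, 376, 312, 560, 885, 1639],
      [114, 171, 259, 204, 94, 78, 140, 171, 259, 402],
      [26, 39, 47, 42, 32, 54, 44, 39, 47, 60, 86]]"
  have "lcf_certificate 12 P" unfolding P_def by code_simp
  moreover have "map (\<lambda>i. lcf_dot 12 P i i) [0..<11] = [3, 8, 21, 55, 144, 377, 816, 1639, 3216, 688, 144]"
    unfolding P_def by code_simp
  moreover have "map (\<lambda>i. P ! i ! i) [0..<11] = [1, 3, 8, 21, 55, 144, 377, 816, 1639, 402, 86]"
    unfolding P_def by code_simp
  ultimately show ?thesis
    using complexity_lcf_graph[of 12 f P] lcf_ok_12 assms by (simp add: prod_lessThan_of_map)
qed

lemma lcf_ok_14: "lcf_ok 14"
  by code_simp

text \<open>The value is \<open>3 * 7 ^ 5\<close>, in accordance with the adjacency eigenvalues 3,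
  -3 and plus or minus the square root of 2 (six times each) of the Heawood graph.\<close>

lemma complexity_lcf_14:
  assumes "inj_on f {..<14}"
  shows "complexity (lcf_graph f 14) = 50421"
proof -
  define P :: "int list list" where "P =
     [[1],
      [1, 3],
      [1, 3, 8],
      [1, 3, 8, 21],
      [1, 3, 8, 21, 55],
      [1, 3, 8, 21, 55, 144],
      [56, 168, 71, 45, 64, 147, 377],
      [56, 168, 71, 45, 64, 147, 377, 816],
      [120, 360, 448, 984, 433, 315, 512, 861, 2071],
      [264, 168, 112, 168, 79, 69, 128, 147, 313, 624],
      [49, 48, 32, 48, 49, 99, 63, 42, 63, 99, 185],
      [14, 21, 31, 21, 14, 21, 18, 12, 18, 21, 31, 51],
      [4, 6, 7, 6, 4, 6, 7, 9, 7, 6, 7, 9, 13]]"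
  have "lcf_certificate 14 P" unfolding P_def by code_simp
  moreover have "map (\<lambda>i. lcf_dot 14 P i i) [0..<13] = [3, 8, 21, 55, 144, 377, 816, 2071, 4368, 1295, 357, 91, 21]"
    unfolding P_def by code_simp
  moreover have "map (\<lambda>i. P ! i ! i) [0..<13] = [1, 3, 8, 21, 55, 144, 377, 816, 2071, 624, 185, 51, 13]"
    unfolding P_def by code_simp
  ultimately show ?thesis
    using complexity_lcf_graph[of 14 f P] lcf_ok_14 assms by (simp add: prod_lessThan_of_map)
qed

section \<open>Cubic graphs with a cut of at most two edges\<close>

text \<open>An enumeration of the vertices of \<open>G\<close> places the LCF graph on the same
  vertex set, where maximality applies.\<close>

lemma max_complexity_ge:
  assumes "max_complexity_cubic n G" "lcf_ok n" "0 < n"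
    and "\<And>f. inj_on f {..<n} \<Longrightarrow> complexity (lcf_graph f n :: 'a pair_pre_digraph) = c"
  shows "c \<le> complexity (G :: 'a pair_pre_digraph)"
proof -
  have "card (pverts G) = n" using assms(1) by (simp add: max_complexity_cubic_def)
  moreover from this have "finite (pverts G)" using assms(3) by (simp add: card_ge_0_finite)
  ultimately obtain f where f: "bij_betw f {0..<n} (pverts G)" using ex_bij_betw_nat_finite by blast
  hence inj: "inj_on f {..<n}" by (simp add: bij_betw_def lessThan_atLeast0)
  hence "card (pverts (lcf_graph f n)) = n" by (simp add: lcf_graph_def card_image)
  thus ?thesis
    using assms(1) cubic_lcf_graph[OF assms(2) inj] assms(4)[OF inj]
    unfolding max_complexity_cubic_def by auto
qed

text \<open>The default branch stands for 14 vertices and keeps the value positive for every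
  \<open>n\<close>.\<close>

definition lcf_complexity :: "nat \<Rightarrow> nat" where
  "lcf_complexity n = (if n = 8 then 384 else if n = 10 then 1815 else if n = 12 then 9216 else 50421)"

lemma lcf_complexity_le:
  fixes G :: "'a pair_pre_digraph"
  assumes "max_complexity_cubic n G" "n \<in> {8, 10, 12, 14}"
  shows "lcf_complexity n \<le> complexity G"
  using assms max_complexity_ge[OF _ lcf_ok_8 _ complexity_lcf_8, of G]
    max_complexity_ge[OF _ lcf_ok_10 _ complexity_lcf_10, of G]
    max_complexity_ge[OF _ lcf_ok_12 _ complexity_lcf_12, of G]
    max_complexity_ge[OF _ lcf_ok_14 _ complexity_lcf_14, of G]
  by (auto simp: lcf_complexity_def)

lemma tree_const_1: "tree_const 1 = 1"
  by simp

text \<open>This constant is sharp: three parallel paths of length \<open>L / 3\<close> have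
  \<open>L\<^sup>2 / 3\<close> spanning trees.\<close>

lemma tree_const_2: "tree_const 2 = 1 / 3"
  using tree_const.simps(2)[of 1] tree_const_1 by (simp add: numeral_2_eq_2)

lemma tree_const_3: "tree_const 3 = 25 / 324"
  using tree_const.simps(2)[of 2] tree_const_2 by (simp add: power_divide)

lemma tree_const_4: "tree_const 4 = 800 / 59049"
  using tree_const.simps(2)[of 3] tree_const_3 by (simp add: power_divide)

lemma tree_const_5: "tree_const 5 = 73205 / 38263752"
  using tree_const.simps(2)[of 4] tree_const_4 by (simp add: power_divide)

lemma tree_const_6: "tree_const 6 = 492142574 / 2179240250625"
  using tree_const.simps(2)[of 5] tree_const_5 by (simp add: power_divide)

text \<open>A side of a bridge with \<open>2 * p + 1\<close> vertices has \<open>3 * p + 1\<close>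
  edges and Betti number \<open>p + 1\<close>.\<close>

lemma one_edge_cut_bound:
  assumes "2 \<le> p" "2 \<le> q" "p + q \<le> 6"
  shows "tree_bound (p + 1) (3 * p + 1) * tree_bound (q + 1) (3 * q + 1) <
    real (lcf_complexity (2 * p + 2 * q + 2))"
proof -
  have "p = 2 \<and> q \<in> {2, 3, 4} \<or> p = 3 \<and> q \<in> {2, 3} \<or> p = 4 \<and> q = 2" using assms by auto
  thus ?thesis
    by (elim disjE conjE insertE emptyE)
      (simp_all add: tree_bound_def lcf_complexity_def tree_const_3 tree_const_4 tree_const_5)
qed

text \<open>The first term belongs to the trees with one cut edge, the other two to those with both,
  where one side has its feet identified and so Betti number one higher. With at least 4 vertices
  per side, only ten pairs remain.\<close>

lemma two_edge_cut_bound: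
  assumes "2 \<le> p" "2 \<le> q" "p + q \<le> 7"
  shows "2 * tree_bound p (3 * p - 1) * tree_bound q (3 * q - 1) +
      tree_bound p (3 * p - 1) * tree_bound (Suc q) (3 * q - 1) +
      tree_bound (Suc p) (3 * p - 1) * tree_bound q (3 * q - 1) <
    real (lcf_complexity (2 * p + 2 * q))"
proof -
  have "p = 2 \<and> q \<in> {2, 3, 4, 5} \<or> p = 3 \<and> q \<in> {2, 3, 4} \<or> p = 4 \<and> q \<in> {2, 3} \<or> p = 5 \<and> q = 2"
    using assms by auto
  thus ?thesis
    by (elim disjE conjE insertE emptyE)
      (simp_all add: tree_bound_def lcf_complexity_def
        tree_const_2 tree_const_3 tree_const_4 tree_const_5 tree_const_6)
qed

text \<open>Handshake on \<open>X\<close>: an inner edge is counted at both ends, a cut edge at one.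
  The second bound holds because the graph is simple.\<close>

lemma cubic_cut_counts:
  assumes "cubic_graph G" "vertex_cut (pverts G) (\<lambda>e. e) (edges G) X"
  shows "3 * card X = 2 * card {e \<in> edges G. e \<subseteq> X} + card (vertex_cut.cut (pverts G) (\<lambda>e. e) (edges G) X)"
    and "2 * card {e \<in> edges G. e \<subseteq> X} \<le> card X * (card X - 1)"
proof -
  interpret vertex_cut "pverts G" "\<lambda>e. e" "edges G" X by fact
  have pg: "pair_graph G" using assms(1) by (simp add: cubic_graph_def)
  interpret pair_graph G by (rule pg)
  have fX: "finite X" using X(1) fin(1) finite_subset by blast
  have two: "card e = 2" if "e \<in> edges G" for e
    using that no_loops' by (auto elim!: edgeE simp: card_insert_if)
  have "3 * card X = (\<Sum>v\<in>X. 3)" by simp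
  also have "\<dots> = (\<Sum>v\<in>X. card {e \<in> edges G. v \<in> e \<inter> X})"
    using X(1) card_incident[OF assms(1)] by (intro sum.cong) auto
  also have "\<dots> = (\<Sum>e\<in>edges G. card (e \<inter> X))"
    using sum_inc_card[OF fX fin(2), of "\<lambda>e. e \<inter> X"] by simp
  also have "\<dots> = (\<Sum>e\<in>inner X \<union> inner (pverts G - X) \<union> cut. card (e \<inter> X))"
    using E_eq by simp
  also have "\<dots> = (\<Sum>e\<in>inner X. card (e \<inter> X)) + (\<Sum>e\<in>inner (pverts G - X). card (e \<inter> X)) +
      (\<Sum>e\<in>cut. card (e \<inter> X))"
    using disj fin(2) by (subst sum.union_disjoint; (subst sum.union_disjoint)?) (auto simp: cut_def)
  also have "(\<Sum>e\<in>inner X. card (e \<inter> X)) = (\<Sum>e\<in>inner X. 2)"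
    using two by (intro sum.cong) (auto simp: Int_absorb2)
  also have "(\<Sum>e\<in>inner (pverts G - X). card (e \<inter> X)) = (\<Sum>e\<in>inner (pverts G - X). 0)"
  proof (rule sum.cong[OF refl])
    fix e assume "e \<in> inner (pverts G - X)"
    hence "e \<inter> X = {}" by blast
    thus "card (e \<inter> X) = 0" by simp
  qed
  also have "(\<Sum>e\<in>cut. card (e \<inter> X)) = (\<Sum>e\<in>cut. 1)"
  proof (rule sum.cong[OF refl])
    fix e assume "e \<in> cut"
    then obtain a b where "a \<in> X" "b \<in> pverts G - X" "e = {a, b}" by (rule cut_ends)
    hence "e \<inter> X = {a}" by auto
    thus "card (e \<inter> X) = 1" by simp
  qed
  finally show "3 * card X = 2 * card (inner X) + card cut" by simp
  have "card (inner X) \<le> card {e. e \<subseteq> X \<and> card e = 2}"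
    using two fX by (intro card_mono) auto
  also have "\<dots> = card X choose 2" by (rule n_subsets[OF fX])
  finally show "2 * card (inner X) \<le> card X * (card X - 1)"
    by (simp add: choose_two)
qed

text \<open>Each side has as many vertices as the cut has edges modulo 2, and at least 4. So the
  sides are both even or both odd, and \<open>n\<close> is an even number from 8 to 14.\<close>

lemma complexity_cut_small:
  assumes "cubic_graph G" "card (pverts G) = n" "n \<le> 14"
    and cut: "vertex_cut (pverts G) (\<lambda>e. e) (edges G) X"
      "card (vertex_cut.cut (pverts G) (\<lambda>e. e) (edges G) X) \<le> 2"
  shows "n \<in> {8, 10, 12, 14} \<and> complexity G < lcf_complexity n"
proof -
  interpret vertex_cut "pverts G" "\<lambda>e. e" "edges G" X by fact
  have pg: "pair_graph G" using assms(1) by (simp add: cubic_graph_def)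
  let ?V = "pverts G" and ?Y = "pverts G - X"
  define a b mA mB where ab: "a = card X" "b = card ?Y" "mA = card (inner X)" "mB = card (inner ?Y)"
  have fX: "finite X" "finite ?Y" using X(1) fin by (auto intro: finite_subset)
  have n: "n = a + b" using card_V assms(2) by (simp add: ab)
  have pos: "a \<noteq> 0" "b \<noteq> 0" using X fX by (auto simp: ab)
  have cA: "3 * a = 2 * mA + card cut" "2 * mA \<le> a * (a - 1)"
    using cubic_cut_counts[OF assms(1) cut(1)] by (simp_all add: ab)
  have cB: "3 * b = 2 * mB + card cut" "2 * mB \<le> b * (b - 1)"
    using cubic_cut_counts[OF assms(1) complement] by (simp_all add: ab cut_complement)
  have mgX: "multigraph X (\<lambda>e. e) (inner X)" and mgY: "multigraph ?Y (\<lambda>e. e) (inner ?Y)"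
    using multigraph_restrict[OF mg] X(1) by auto
  \<comment> \<open>The two counts give \<open>x * (4 - x) \<le> c\<close>, but the left side is 3,
    4, 3 for \<open>x\<close> = 1, 2, 3.\<close>
  have big: "4 \<le> x" if "x \<noteq> 0" "3 * x = 2 * m + c" "2 * m \<le> x * (x - 1)" "c \<le> 2" for x m c :: nat
  proof (rule ccontr)
    assume "\<not> 4 \<le> x"
    hence "x = 1 \<or> x = 2 \<or> x = 3" using that(1) by linarith
    thus False using that by (elim disjE) simp_all
  qed
  have ge4: "4 \<le> a" "4 \<le> b" using big[OF pos(1) cA cut(2)] big[OF pos(2) cB cut(2)] by auto
  have C: "complexity G = num_trees ?V (\<lambda>e. e) (edges G)" by (rule complexity_eq_num_trees[OF pg])
  let ?NA = "num_trees X (\<lambda>e. e) (inner X)" and ?NB = "num_trees ?Y (\<lambda>e. e) (inner ?Y)"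
  consider "card cut = 0" | "card cut = 1" | "card cut = 2" using cut(2) by linarith
  thus ?thesis
  proof cases
    case 1
    hence "cut = {}" using fin by (simp add: cut_def)
    hence "complexity G = 0" using num_trees_cut_empty C by simp
    moreover have "even a" "even b" using cA(1) cB(1) 1 by presburger+
    hence "n \<in> {8, 10, 12, 14}" using n ge4 assms(3) by (auto elim!: evenE) presburger
    moreover have "0 < lcf_complexity n" by (simp add: lcf_complexity_def)
    ultimately show ?thesis by simp
  next
    case 2
    then obtain e where e: "cut = {e}" by (auto simp: card_1_singleton_iff)
    have "odd a" "odd b" using cA(1) cB(1) 2 by presburger+
    then obtain p q where pq: "a = 2 * p + 1" "b = 2 * q + 1" by (auto elim!: oddE)
    have m: "mA = 3 * p + 1" "mB = 3 * q + 1" using cA(1) cB(1) 2 pq by auto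
    have le: "2 \<le> p" "2 \<le> q" "p + q \<le> 6" using ge4 pq n assms(3) by auto
    have "real ?NA \<le> tree_bound (p + 1) mA"
      unfolding ab(3) using num_trees_bound[OF mgX, of "p + 1"] m(1) pq(1) ab by simp
    moreover have "real ?NB \<le> tree_bound (q + 1) mB"
      unfolding ab(4) using num_trees_bound[OF mgY, of "q + 1"] m(2) pq(2) ab by simp
    ultimately have "real ?NA * real ?NB \<le> tree_bound (p + 1) mA * tree_bound (q + 1) mB"
      by (intro mult_mono tree_bound_nonneg) auto
    also have "\<dots> < real (lcf_complexity (2 * p + 2 * q + 2))"
      unfolding m by (rule one_edge_cut_bound[OF le])
    also have "2 * p + 2 * q + 2 = n" using n pq by simp
    finally have "?NA * ?NB < lcf_complexity n" unfolding of_nat_mult[symmetric] of_nat_less_iff .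
    hence "complexity G < lcf_complexity n" using num_trees_cut_one[OF e] C by simp
    moreover have "p + q = 4 \<or> p + q = 5 \<or> p + q = 6" using le by linarith
    hence "n \<in> {8, 10, 12, 14}" using n pq by auto
    ultimately show ?thesis by blast
  next
    case 3
    then obtain e1 e2 where e: "cut = {e1, e2}" "e1 \<noteq> e2" by (auto simp: card_2_iff)
    have "e1 \<in> cut" "e2 \<in> cut" using e by auto
    then obtain a1 b1 a2 b2 where ends: "a1 \<in> X" "b1 \<in> ?Y" "e1 = {a1, b1}" "a2 \<in> X" "b2 \<in> ?Y" "e2 = {a2, b2}"
      by (elim cut_ends)
    have "even a" "even b" using cA(1) cB(1) 3 by presburger+
    then obtain p q where pq: "a = 2 * p" "b = 2 * q" by (auto elim!: evenE)
    have m: "mA = 3 * p - 1" "mB = 3 * q - 1" using cA(1) cB(1) 3 pq by auto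
    have le: "2 \<le> p" "2 \<le> q" "p + q \<le> 7" using ge4 pq n assms(3) by auto
    let ?MA = "num_merged a1 a2 X (\<lambda>e. e) (inner X)" and ?MB = "num_merged b1 b2 ?Y (\<lambda>e. e) (inner ?Y)"
    have kA: "mA + 1 = a + p" and kB: "mB + 1 = b + q" using m pq le by auto
    have NA: "real ?NA \<le> tree_bound p mA"
      unfolding ab(3) using kA by (intro num_trees_bound[OF mgX]) (simp add: ab)
    have NB: "real ?NB \<le> tree_bound q mB"
      unfolding ab(4) using kB by (intro num_trees_bound[OF mgY]) (simp add: ab)
    have MA: "real ?MA \<le> tree_bound (Suc p) mA"
      unfolding ab(3) using kA by (intro num_merged_bound[OF mgX ends(1,4)]) (simp add: ab)
    have MB: "real ?MB \<le> tree_bound (Suc q) mB"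
      unfolding ab(4) using kB by (intro num_merged_bound[OF mgY ends(2,5)]) (simp add: ab)
    have "complexity G \<le> 2 * ?NA * ?NB + ?NA * ?MB + ?MA * ?NB"
      unfolding C by (rule num_trees_cut_two[OF e ends])
    hence "real (complexity G) \<le> real (2 * ?NA * ?NB + ?NA * ?MB + ?MA * ?NB)"
      by (rule of_nat_mono)
    also have "\<dots> = 2 * real ?NA * real ?NB + real ?NA * real ?MB + real ?MA * real ?NB" by simp
    also have "\<dots> \<le> 2 * tree_bound p mA * tree_bound q mB + tree_bound p mA * tree_bound (Suc q) mB +
        tree_bound (Suc p) mA * tree_bound q mB"
      using NA NB MA MB by (intro add_mono mult_mono mult_nonneg_nonneg tree_bound_nonneg) auto
    also have "\<dots> < real (lcf_complexity (2 * p + 2 * q))"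
      unfolding m by (rule two_edge_cut_bound[OF le])
    also have "2 * p + 2 * q = n" using n pq by simp
    finally have "complexity G < lcf_complexity n" unfolding of_nat_less_iff .
    moreover have "p + q = 4 \<or> p + q = 5 \<or> p + q = 6 \<or> p + q = 7" using le by linarith
    hence "n \<in> {8, 10, 12, 14}" using n pq by auto
    ultimately show ?thesis by blast
  qed
qed

theorem corollary5p3:
  fixes \<Gamma> :: "'a pair_pre_digraph" and g :: nat
  assumes "2 \<le> g" and "g \<le> 8"
    and "max_complexity_cubic (2 * g - 2) \<Gamma>"
  shows "k_connected 3 \<Gamma>"
proof -
  define n where "n = 2 * g - 2"
  have max: "max_complexity_cubic n \<Gamma>" using assms(3) by (simp add: n_def)
  have cubic: "cubic_graph \<Gamma>" and card: "card (pverts \<Gamma>) = n"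
    using max by (auto simp: max_complexity_cubic_def)
  have pg: "pair_graph \<Gamma>" using cubic by (simp add: cubic_graph_def)
  have n: "n \<noteq> 0" "n \<le> 14" using assms(1,2) by (auto simp: n_def)
  hence V: "pverts \<Gamma> \<noteq> {}" using card by auto
  have "connected (with_proj (del_edges \<Gamma> S))" if S: "S \<subseteq> edges \<Gamma>" "card S = 2" for S
  proof (rule ccontr)
    assume "\<not> ?thesis"
    hence "\<not> linked (pverts \<Gamma>) (\<lambda>e. e) (edges \<Gamma> - S)"
      using connected_iff_linked[OF pair_graph_del_edges[OF pg], of S]
      by (simp add: edges_del_edges) (simp add: del_edges_def)
    then obtain X where sep: "X \<subseteq> pverts \<Gamma>" "X \<noteq> {}" "X \<noteq> pverts \<Gamma>"
        "\<forall>e\<in>edges \<Gamma> - S. e \<inter> X = {} \<or> e \<subseteq> X"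
      using not_linkedE[OF _ V] by metis
    have cut: "vertex_cut (pverts \<Gamma>) (\<lambda>e. e) (edges \<Gamma>) X"
      using sep multigraph_edges[OF pg] by unfold_locales
    interpret vertex_cut "pverts \<Gamma>" "\<lambda>e. e" "edges \<Gamma>" X by (rule cut)
    \<comment> \<open>Only inclusion holds: the cut is smaller than \<open>S\<close> if a single
      edge, or none at all, already separates \<open>X\<close>. This is why cuts of size 0 and 1
      were treated as well.\<close>
    have "vertex_cut.cut (pverts \<Gamma>) (\<lambda>e. e) (edges \<Gamma>) X \<subseteq> S"
    proof
      fix e assume e: "e \<in> vertex_cut.cut (pverts \<Gamma>) (\<lambda>e. e) (edges \<Gamma>) X"
      then obtain a b where ab: "a \<in> X" "b \<in> pverts \<Gamma> - X" "e = {a, b}" by (rule cut_ends)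
      have "\<not> (e \<inter> X = {} \<or> e \<subseteq> X)" using ab by auto
      moreover have "e \<in> edges \<Gamma>" using e by (simp add: cut_def)
      ultimately show "e \<in> S" using sep(4) by blast
    qed
    moreover have "finite S" using S(2) by (simp add: card_ge_0_finite)
    ultimately have "card (vertex_cut.cut (pverts \<Gamma>) (\<lambda>e. e) (edges \<Gamma>) X) \<le> 2"
      using card_mono[of S] S(2) by metis
    hence "n \<in> {8, 10, 12, 14} \<and> complexity \<Gamma> < lcf_complexity n"
      using complexity_cut_small[OF cubic card n(2) cut] by blast
    thus False using lcf_complexity_le[OF max] by simp
  qed
  thus ?thesis by (simp add: k_connected_def)
qed

end
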